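(* Let $H$ be a connected graph with $\Delta(H)\geq 7$ that is $(K_{\Delta(H)}\setminus e)$-free, and let $p$ and $q$ be two integers satisfying $p,q\geq 2$ and $\Delta(H)+1=p+q$. Then there exists a partition $(V_1,V_2)$ of $V(H)$ such that $H[V_1]$ is $K_p$-free, and either $H[V_2]$ is $K_q$-free or its $q$-cliques are disjoint.
   Context: All graphs are finite, undirected and simple. $\Delta(\cdot)$ denotes the maximum degree, $H[W]$ the subgraph of $H$ induced on $W\subseteq V(H)$, and $K_n$ the complete graph on $n$ vertices; $K_n\setminus e$ is the graph obtained from $K_n$ by removing one edge. For a graph $G$, a graph is $G$-free if it contains no subgraph (not necessarily induced) isomorphic to $G$. A $q$-clique of a graph is a complete subgraph on $q$ vertices; "its $q$-cliques are disjoint" means that any two distinct $q$-cliques have no common vertex. *)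

theory Defs
  imports "Graph_Theory.Graph_Theory"
begin

text \<open>
  Finite simple undirected graphs are those satisfying the locale predicate \<^const>\<open>graph\<close>: finite,
  loop-free, symmetric digraphs without parallel arcs. An undirected edge \<open>uv\<close> is thus a pair of
  opposite arcs, and the degree of a vertex is its out-degree.
\<close>

definition max_degree :: "('a,'b) pre_digraph \<Rightarrow> nat" where
  "max_degree H = Max (out_degree H ` verts H)"

definition complete_graph :: "nat \<Rightarrow> nat pair_pre_digraph" where
  "complete_graph n = \<lparr> pverts = {..<n}, parcs = {(u,v). u < n \<and> v < n \<and> u \<noteq> v} \<rparr>"

text \<open>
  The removed edge is \<open>{0,1}\<close>; up to isomorphism the choice is irrelevant. The definition is meant
  for \<open>n \<ge> 2\<close>.
\<close>
definition complete_graph_minus_edge :: "nat \<Rightarrow> nat pair_pre_digraph" where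
  "complete_graph_minus_edge n =
     \<lparr> pverts = pverts (complete_graph n), parcs = parcs (complete_graph n) - {(0,1), (1,0)} \<rparr>"

text \<open>
  \<^const>\<open>subgraph\<close> also admits non-symmetric subdigraphs, but one that is isomorphic to a
  (symmetric) graph \<open>G\<close> is itself symmetric.
\<close>
definition free_of :: "('c,'d) pre_digraph \<Rightarrow> ('a,'b) pre_digraph \<Rightarrow> bool" where
  "free_of G H \<longleftrightarrow> \<not> (\<exists>S. subgraph S H \<and> digraph_iso S G)"

definition clique_of :: "nat \<Rightarrow> ('a,'b) pre_digraph \<Rightarrow> ('a,'b) pre_digraph \<Rightarrow> bool" where
  "clique_of q H C \<longleftrightarrow> subgraph C H \<and> complete_digraph q C"

definition disjoint_cliques :: "nat \<Rightarrow> ('a,'b) pre_digraph \<Rightarrow> bool" where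
  "disjoint_cliques q H \<longleftrightarrow>
     (\<forall>C D. clique_of q H C \<and> clique_of q H D \<and> C \<noteq> D \<longrightarrow> verts C \<inter> verts D = {})"

lemma complete_digraph_complete_graph: "complete_digraph n (with_proj (complete_graph n))"
  by (auto simp: complete_digraph_pair_def complete_graph_def)

lemma pair_graph_complete_graph_minus_edge: "pair_graph (complete_graph_minus_edge n)"
proof -
  have "finite {(u,v). u < n \<and> v < n \<and> u \<noteq> v}"
    by (rule finite_subset[of _ "{..<n} \<times> {..<n}"]) auto
  then show ?thesis
    by unfold_locales
      (auto simp: complete_graph_minus_edge_def complete_graph_def symmetric_def intro: symI)
qed

end

theory Submission
  imports Defs "HOL-Library.Product_Lexorder" "HOL-Library.Disjoint_Sets"
begin

text \<open>
  Let \<open>\<Delta>\<close> be the maximum degree, so that \<open>p + q = \<Delta> + 1\<close>. Take for \<open>V2\<close> a smallest set \<open>S\<close> of vertices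
  that meets every \<open>p\<close>-clique, and for \<open>V1\<close> its complement. Each \<open>v \<in> S\<close> is needed, so it completes a
  \<open>p\<close>-clique with vertices outside \<open>S\<close>; hence \<open>v\<close> has at least \<open>p - 1\<close> neighbours outside \<open>S\<close> and at
  most \<open>q\<close> inside. If two different \<open>q\<close>-cliques inside \<open>S\<close> meet in \<open>v\<close>, then \<open>v\<close> has exactly \<open>q\<close>
  neighbours in \<open>S\<close> and these form a clique up to one missing edge. Call such a \<open>v\<close> a core vertex of
  \<open>S\<close>. The aim is an \<open>S\<close> without core vertices.
  
  The neighbours of a core vertex \<open>v\<close> outside \<open>S\<close> form a \<open>(p - 1)\<close>-clique \<open>K\<close>, and replacing \<open>v\<close> by any
  \<open>w \<in> K\<close> gives another smallest hitting set. If \<open>S\<close> also has the fewest edges, and then the smallest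
  value of a suitable clique count, this \<open>w\<close> is a core vertex of the new set (\<open>core_exchange\<close>). So every
  vertex of the \<open>p\<close>-clique \<open>insert v K\<close> carries its own near-clique of \<open>q\<close> further neighbours. There is no
  near-clique on \<open>\<Delta>\<close> vertices, which forces these attached near-cliques apart: a neighbour of
  \<open>v\<close> in \<open>S\<close> that dominates the near-clique around \<open>v\<close> has no neighbour in \<open>K\<close> (\<open>dominating_neighbour_private\<close>).
  
  For \<open>q \<ge> 3\<close> this allows an endless walk: exchange \<open>v\<close> for \<open>w\<close>, pass from \<open>w\<close> to another core
  vertex of the near-clique around \<open>w\<close>, exchange that one, and so on. The cliques through which the walk
  has left stay outside the hitting set for ever (\<open>walk_never_returns\<close>), so the walk visits infinitely
  many vertices, which is absurd. Hence an optimal \<open>S\<close> has no core vertices at all.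
  
  For \<open>q = 2\<close> a core vertex is merely the middle of a path with two edges, and the walk need not have a
  next vertex. But then \<open>p = \<Delta> - 1\<close> is so large that the \<open>p\<close>-cliques can be described: a \<open>p\<close>-clique meets
  at most one other, in \<open>p - 2\<close> vertices. The common parts of these clusters are disjoint, have at
  least four vertices each, and a vertex of one of them has at most two neighbours outside its clique.
  Choosing one vertex from each common part so that the chosen vertices induce maximum degree at most one
  (\<open>transversal_degree_one\<close>) gives the hitting set.
\<close>

section \<open>Cliques and near-cliques\<close>

locale adjacency =
  fixes V :: "'v set" and adj :: "'v \<Rightarrow> 'v \<Rightarrow> bool"
  assumes finite_V: "finite V"
    and adj_in_V: "adj x y \<Longrightarrow> x \<in> V"
    and adj_sym: "adj x y \<Longrightarrow> adj y x"
    and adj_irrefl: "\<not> adj x x"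
begin

definition nbrs :: "'v \<Rightarrow> 'v set" where
  "nbrs x = {y. adj x y}"

definition clique :: "'v set \<Rightarrow> bool" where
  "clique A \<longleftrightarrow> (\<forall>x\<in>A. \<forall>y\<in>A. x \<noteq> y \<longrightarrow> adj x y)"

text \<open>
  The pair \<open>{c, d}\<close> is the missing edge. Its ends are not required to lie in \<open>A\<close>, so cliques and subsets
  of near-cliques are near-cliques.
\<close>
definition near_clique :: "'v set \<Rightarrow> bool" where
  "near_clique A \<longleftrightarrow> (\<exists>c d. \<forall>x\<in>A. \<forall>y\<in>A. x \<noteq> y \<longrightarrow> adj x y \<or> {x, y} = {c, d})"

definition clique_free :: "nat \<Rightarrow> 'v set \<Rightarrow> bool" where
  "clique_free k S \<longleftrightarrow> (\<forall>A\<subseteq>S. clique A \<longrightarrow> card A \<noteq> k)"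

definition cliques_disjoint :: "nat \<Rightarrow> 'v set \<Rightarrow> bool" where
  "cliques_disjoint k S \<longleftrightarrow> (\<forall>A\<subseteq>S. \<forall>B\<subseteq>S. clique A \<longrightarrow> clique B \<longrightarrow>
     card A = k \<longrightarrow> card B = k \<longrightarrow> A \<noteq> B \<longrightarrow> A \<inter> B = {})"

lemma nbrs_sym: "y \<in> nbrs x \<longleftrightarrow> x \<in> nbrs y"
  unfolding nbrs_def using adj_sym by blast

lemma nbrs_irrefl [simp]: "x \<notin> nbrs x"
  unfolding nbrs_def using adj_irrefl by simp

lemma nbrs_subset: "nbrs x \<subseteq> V"
  unfolding nbrs_def using adj_in_V adj_sym by blast

lemma finite_nbrs [simp]: "finite (nbrs x)"
  using finite_subset[OF nbrs_subset finite_V] .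

lemma cliqueD: "clique A \<Longrightarrow> x \<in> A \<Longrightarrow> y \<in> A \<Longrightarrow> x \<noteq> y \<Longrightarrow> y \<in> nbrs x"
  unfolding clique_def nbrs_def by blast

lemma cliqueI: "(\<And>x y. x \<in> A \<Longrightarrow> y \<in> A \<Longrightarrow> x \<noteq> y \<Longrightarrow> y \<in> nbrs x) \<Longrightarrow> clique A"
  unfolding clique_def nbrs_def by blast

lemma clique_mono: "clique A \<Longrightarrow> B \<subseteq> A \<Longrightarrow> clique B"
  unfolding clique_def by blast

lemma near_clique_mono: "near_clique A \<Longrightarrow> B \<subseteq> A \<Longrightarrow> near_clique B"
  unfolding near_clique_def by (meson subsetD)

lemma clique_near_clique: "clique A \<Longrightarrow> near_clique A"
  unfolding clique_def near_clique_def by blast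

lemma clique_insert: "clique (insert z A) \<longleftrightarrow> clique A \<and> A - {z} \<subseteq> nbrs z"
  unfolding clique_def nbrs_def using adj_sym by blast

lemma near_clique_nonadjacent:
  assumes "near_clique A" "a \<in> A" "b \<in> A" "a \<noteq> b" "b \<notin> nbrs a"
    and "x \<in> A" "y \<in> A" "x \<noteq> y" "{x, y} \<noteq> {a, b}"
  shows "y \<in> nbrs x"
proof -
  obtain c d where *: "\<And>x y. x \<in> A \<Longrightarrow> y \<in> A \<Longrightarrow> x \<noteq> y \<Longrightarrow> adj x y \<or> {x, y} = {c, d}"
    using assms(1) unfolding near_clique_def by blast
  have "{a, b} = {c, d}"
    using *[of a b] assms(2-5) unfolding nbrs_def by auto
  then show ?thesis
    using *[of x y] assms(6-9) unfolding nbrs_def by auto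
qed

lemma near_clique_dominating:
  assumes "near_clique A" "finite A" "3 \<le> card A"
  obtains u where "u \<in> A" "A - {u} \<subseteq> nbrs u"
proof -
  obtain c d where *: "\<And>x y. x \<in> A \<Longrightarrow> y \<in> A \<Longrightarrow> x \<noteq> y \<Longrightarrow> adj x y \<or> {x, y} = {c, d}"
    using assms(1) unfolding near_clique_def by blast
  have "card {c, d} \<le> 2"
    by (simp add: card_insert_if)
  then have "\<not> A \<subseteq> {c, d}"
    using assms(3) card_mono[of "{c, d}" A] by auto
  then obtain u where "u \<in> A" "u \<notin> {c, d}"
    by blast
  moreover have "A - {u} \<subseteq> nbrs u"
    using * \<open>u \<in> A\<close> \<open>u \<notin> {c, d}\<close> unfolding nbrs_def by blast
  ultimately show thesis
    using that by blast
qed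

definition num_cliques :: "nat \<Rightarrow> 'v set \<Rightarrow> nat" where
  "num_cliques k S = card {A. A \<subseteq> S \<and> clique A \<and> card A = k}"

text \<open>
  The new cliques are those through \<open>z\<close>, and they correspond to the smaller cliques in its neighbourhood.
\<close>
lemma num_cliques_insert:
  assumes "finite S" "z \<notin> S"
  shows "num_cliques (Suc k) (insert z S) = num_cliques (Suc k) S + num_cliques k (nbrs z \<inter> S)"
proof -
  let ?C = "\<lambda>k S. {A. A \<subseteq> S \<and> clique A \<and> card A = k}"
  have fin: "finite (?C k S)" if "finite S" for k S
    using that by simp
  have eq: "?C (Suc k) (insert z S) = ?C (Suc k) S \<union> insert z ` ?C k (nbrs z \<inter> S)"
  proof (intro equalityI subsetI)
    fix A assume A: "A \<in> ?C (Suc k) (insert z S)"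
    show "A \<in> ?C (Suc k) S \<union> insert z ` ?C k (nbrs z \<inter> S)"
    proof (cases "z \<in> A")
      case True
      have "A - {z} \<subseteq> nbrs z \<inter> S"
        using A True clique_insert[of z "A - {z}"] by (auto simp: insert_absorb)
      moreover have "card (A - {z}) = k" "clique (A - {z})"
        using A True by (auto intro: clique_mono)
      ultimately have "A - {z} \<in> ?C k (nbrs z \<inter> S)"
        by blast
      moreover have "A = insert z (A - {z})"
        using True by blast
      ultimately show ?thesis
        by blast
    qed (use A in auto)
  next
    fix A assume A: "A \<in> ?C (Suc k) S \<union> insert z ` ?C k (nbrs z \<inter> S)"
    show "A \<in> ?C (Suc k) (insert z S)"
    proof (cases "A \<in> ?C (Suc k) S")
      case False
      then obtain B where B: "A = insert z B" "B \<subseteq> nbrs z \<inter> S" "clique B" "card B = k"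
        using A by blast
      have "finite B"
        using finite_subset[OF B(2)] by simp
      moreover have "z \<notin> B"
        using B(2) assms(2) by blast
      ultimately show ?thesis
        using B by (auto simp: clique_insert)
    qed auto
  qed
  have "card (?C (Suc k) S \<union> insert z ` ?C k (nbrs z \<inter> S))
      = card (?C (Suc k) S) + card (insert z ` ?C k (nbrs z \<inter> S))"
    by (rule card_Un_disjoint) (use assms in auto)
  moreover have "card (insert z ` ?C k (nbrs z \<inter> S)) = card (?C k (nbrs z \<inter> S))"
    by (rule card_image, rule inj_onI) (use assms(2) in \<open>auto simp: insert_ident subset_iff\<close>)
  ultimately show ?thesis
    unfolding num_cliques_def eq by simp
qed

lemma num_cliques_1 [simp]: "num_cliques (Suc 0) S = card S"
proof -
  have "{A. A \<subseteq> S \<and> clique A \<and> card A = Suc 0} = (\<lambda>x. {x}) ` S"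
    by (auto simp: card_Suc_eq clique_def)
  then show ?thesis
    unfolding num_cliques_def by (simp add: card_image)
qed

lemma num_cliques_card: "finite S \<Longrightarrow> num_cliques (card S) S = (if clique S then 1 else 0)"
proof -
  assume "finite S"
  then have "{A. A \<subseteq> S \<and> clique A \<and> card A = card S} = (if clique S then {S} else {})"
    by (auto dest: card_subset_eq)
  then show ?thesis
    unfolding num_cliques_def by simp
qed

lemma codim1_subset:
  assumes "finite D" "A \<subseteq> D" "card A + 1 = card D"
  obtains d where "d \<in> D" "A = D - {d}"
proof -
  have "card (D - A) = 1"
    using assms by (simp add: card_Diff_subset finite_subset)
  then obtain d where "D - A = {d}"
    by (auto simp: card_1_singleton_iff)
  then have "d \<in> D" "A = D - {d}"
    using assms(2) by auto
  then show thesis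
    using that by blast
qed

text \<open>
  A \<open>k\<close>-clique in a set of \<open>k + 1\<close> vertices omits one vertex. If the set is a clique, there are \<open>k + 1\<close>
  of them; if exactly one edge is missing, there are two, which omit one end each; otherwise there is at
  most one, because two of them would cover all pairs but one. Subtracting \<open>k - 1\<close> for a full clique
  makes the first two cases agree, so the difference attains its maximum exactly on near-cliques.
\<close>
lemma num_cliques_near:
  assumes "finite D" "card D = Suc k" "1 \<le> k"
  shows "int (num_cliques k D) - (int k - 1) * int (num_cliques (Suc k) D) = 2 \<longleftrightarrow> near_clique D"
    and "int (num_cliques k D) - (int k - 1) * int (num_cliques (Suc k) D) \<le> 2"
proof -
  let ?C = "{A. A \<subseteq> D \<and> clique A \<and> card A = k}"
  let ?l = "int (num_cliques k D) - (int k - 1) * int (num_cliques (Suc k) D)"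
  have top: "num_cliques (Suc k) D = (if clique D then 1 else 0)"
    using num_cliques_card[OF assms(1)] assms(2) by simp
  have "?l = 2 \<and> near_clique D \<or> ?l \<le> 1 \<and> \<not> near_clique D"
  proof (cases "clique D")
    case True
    have "?C = (\<lambda>d. D - {d}) ` D"
    proof (intro equalityI subsetI)
      fix A assume "A \<in> ?C"
      then show "A \<in> (\<lambda>d. D - {d}) ` D"
        using codim1_subset[of D A] assms by auto
    qed (use assms True in \<open>auto intro: clique_mono\<close>)
    moreover have "inj_on (\<lambda>d. D - {d}) D"
      by (rule inj_onI) blast
    ultimately have "num_cliques k D = Suc k"
      unfolding num_cliques_def using assms(2) by (simp add: card_image)
    then show ?thesis
      using True top by (simp add: clique_near_clique)
  next
    case False
    then obtain a b where ab: "a \<in> D" "b \<in> D" "a \<noteq> b" "b \<notin> nbrs a"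
      using cliqueI by blast
    have sub: "?C \<subseteq> {D - {a}, D - {b}}"
    proof
      fix A assume A: "A \<in> ?C"
      then obtain d where d: "d \<in> D" "A = D - {d}"
        using codim1_subset[of D A] assms by auto
      have "d = a \<or> d = b"
        using A d ab cliqueD[of A a b] by auto
      then show "A \<in> {D - {a}, D - {b}}"
        using d by auto
    qed
    have fin: "finite ?C"
      using assms(1) by simp
    show ?thesis
    proof (cases "near_clique D")
      case True
      have "clique (D - {d})" if "d \<in> {a, b}" for d
        by (rule cliqueI, rule near_clique_nonadjacent[OF True ab])
          (use that in \<open>auto simp: doubleton_eq_iff\<close>)
      then have "?C = {D - {a}, D - {b}}"
        using sub ab assms by auto
      moreover have "D - {a} \<noteq> D - {b}"
        using ab by blast
      ultimately have "num_cliques k D = 2"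
        unfolding num_cliques_def by simp
      then show ?thesis
        using False True top by simp
    next
      case nn: False
      have "\<not> (clique (D - {a}) \<and> clique (D - {b}))"
      proof
        assume *: "clique (D - {a}) \<and> clique (D - {b})"
        have "adj x y \<or> {x, y} = {a, b}" if "x \<in> D" "y \<in> D" "x \<noteq> y" for x y
        proof -
          have "{x, y} = {a, b} \<or> a \<notin> {x, y} \<or> b \<notin> {x, y}"
            using \<open>x \<noteq> y\<close> \<open>a \<noteq> b\<close> by (auto simp: doubleton_eq_iff)
          then show ?thesis
            using that * by (auto simp: clique_def)
        qed
        then show False
          using nn unfolding near_clique_def by blast
      qed
      then have "?C \<subseteq> {D - {a}} \<or> ?C \<subseteq> {D - {b}}"
        using sub by blast
      then have "card ?C \<le> 1"
        using card_mono[of "{D - {a}}" ?C] card_mono[of "{D - {b}}" ?C] by auto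
      then show ?thesis
        using nn top False unfolding num_cliques_def by simp
    qed
  qed
  then show "?l = 2 \<longleftrightarrow> near_clique D" "?l \<le> 2"
    by auto
qed

end

section \<open>Hitting sets and exchanges\<close>

locale degree_split = adjacency V adj
  for V :: "'v set" and adj :: "'v \<Rightarrow> 'v \<Rightarrow> bool" +
  fixes p q :: nat
  assumes two_le_p: "2 \<le> p" and two_le_q: "2 \<le> q"
    and degree: "card (nbrs x) + 1 \<le> p + q"
    and no_near_clique: "S \<subseteq> V \<Longrightarrow> card S + 1 = p + q \<Longrightarrow> \<not> near_clique S"
begin

definition hitting :: "'v set \<Rightarrow> bool" where
  "hitting S \<longleftrightarrow> S \<subseteq> V \<and> (\<forall>A\<subseteq>V. clique A \<and> card A = p \<longrightarrow> A \<inter> S \<noteq> {})"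

definition smallest_hitting :: "'v set \<Rightarrow> bool" where
  "smallest_hitting S \<longleftrightarrow> hitting S \<and> (\<forall>S'. hitting S' \<longrightarrow> card S \<le> card S')"

text \<open>
  The number of \<open>q\<close>-cliques, corrected by the \<open>(q + 1)\<close>-cliques so that adding a vertex \<open>z\<close> with \<open>q\<close>
  neighbours in the set raises it by 2 if \<open>z\<close> becomes a core vertex, and by at most 1 otherwise.
\<close>
definition excess :: "'v set \<Rightarrow> int" where
  "excess S = int (num_cliques q S) - (int q - 2) * int (num_cliques (Suc q) S)"

text \<open>
  Compared lexicographically. The first component bounds the degrees, the second makes an exchanged
  vertex keep \<open>q\<close> neighbours in the set, the third makes it a core vertex again.
\<close>
definition cost :: "'v set \<Rightarrow> nat \<times> nat \<times> int" where
  "cost S = (card S, num_cliques 2 S, excess S)"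

definition optimal :: "'v set \<Rightarrow> bool" where
  "optimal S \<longleftrightarrow> hitting S \<and> (\<forall>S'. hitting S' \<longrightarrow> cost S \<le> cost S')"

definition core :: "'v set \<Rightarrow> 'v \<Rightarrow> bool" where
  "core S v \<longleftrightarrow> v \<in> S \<and> card (nbrs v \<inter> S) = q \<and> near_clique (nbrs v \<inter> S)"

lemma hitting_subset: "hitting S \<Longrightarrow> S \<subseteq> V"
  unfolding hitting_def by blast

lemma hitting_finite: "hitting S \<Longrightarrow> finite S"
  using finite_subset[OF hitting_subset finite_V] .

lemma optimal_exists: "\<exists>S. optimal S"
proof -
  have "hitting V"
    unfolding hitting_def using two_le_p by (auto simp: Int_absorb2)
  moreover have "finite {S. hitting S}"
    by (rule finite_subset[of _ "Pow V"]) (use hitting_subset finite_V in auto)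
  ultimately have "\<exists>S. is_arg_min cost (\<lambda>S. S \<in> {S. hitting S}) S"
    by (intro ex_is_arg_min_if_finite) auto
  then show ?thesis
    unfolding is_arg_min_def optimal_def by (auto simp: not_less)
qed

lemma optimal_smallest: "optimal S \<Longrightarrow> smallest_hitting S"
  unfolding optimal_def smallest_hitting_def cost_def by auto

lemma smallest_hittingD: "smallest_hitting S \<Longrightarrow> hitting S"
  unfolding smallest_hitting_def by blast

lemma smallest_hitting_not_Diff: "smallest_hitting S \<Longrightarrow> v \<in> S \<Longrightarrow> \<not> hitting (S - {v})"
  unfolding smallest_hitting_def by (metis card_Diff1_less hitting_finite not_less)

text \<open>
  Since \<open>S - {v}\<close> misses some \<open>p\<close>-clique, that clique is \<open>v\<close> together with \<open>p - 1\<close> neighbours outside \<open>S\<close>,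
  and the degree bound leaves at most \<open>q\<close> neighbours inside. In the case of equality nothing else is
  adjacent to \<open>v\<close> outside \<open>S\<close>.
\<close>
lemma degree_within_smallest:
  assumes small: "smallest_hitting S" and v: "v \<in> S"
  shows "card (nbrs v \<inter> S) \<le> q"
    and "card (nbrs v \<inter> S) = q \<Longrightarrow> clique (nbrs v - S) \<and> card (nbrs v - S) = p - 1"
proof -
  have S: "S \<subseteq> V" "finite S"
    using small hitting_subset hitting_finite smallest_hittingD by auto
  have "\<not> hitting (S - {v})"
    using smallest_hitting_not_Diff[OF small v] .
  then obtain A where A: "A \<subseteq> V" "clique A" "card A = p" "A \<inter> (S - {v}) = {}"
    using S(1) unfolding hitting_def by blast
  have "A \<inter> S \<noteq> {}"
    using smallest_hittingD[OF small] A unfolding hitting_def by blast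
  then have "v \<in> A"
    using A(4) by blast
  have fin: "finite A"
    using A(1) finite_V finite_subset by blast
  have sub: "A - {v} \<subseteq> nbrs v - S"
    using A(4) cliqueD[OF A(2) \<open>v \<in> A\<close>] by blast
  have cA: "card (A - {v}) = p - 1"
    using fin \<open>v \<in> A\<close> A(3) by simp
  have le: "p - 1 \<le> card (nbrs v - S)"
    using card_mono[OF _ sub] cA by simp
  have sum: "card (nbrs v \<inter> S) + card (nbrs v - S) = card (nbrs v)"
    using card_Int_Diff[of "nbrs v" S] by simp
  then show "card (nbrs v \<inter> S) \<le> q"
    using degree[of v] le two_le_p by linarith
  assume "card (nbrs v \<inter> S) = q"
  then have card: "card (nbrs v - S) = p - 1"
    using degree[of v] le sum two_le_p by linarith
  then have "A - {v} = nbrs v - S"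
    using card_subset_eq[OF _ sub] cA by simp
  then show "clique (nbrs v - S) \<and> card (nbrs v - S) = p - 1"
    using card clique_mono[OF A(2), of "A - {v}"] by auto
qed

text \<open>
  A \<open>p\<close>-clique missed by the new set would consist of \<open>v\<close> and \<open>p - 1\<close> vertices of \<open>nbrs v - S - {w}\<close>,
  which has only \<open>p - 2\<close> elements.
\<close>
lemma smallest_hitting_exchange:
  assumes small: "smallest_hitting S" and v: "v \<in> S" and full: "card (nbrs v \<inter> S) = q"
    and w: "w \<in> nbrs v - S"
  shows "smallest_hitting (insert w (S - {v}))"
proof -
  have "hitting (insert w (S - {v}))"
    unfolding hitting_def
  proof (intro conjI allI impI)
    show "insert w (S - {v}) \<subseteq> V"
      using hitting_subset[OF smallest_hittingD[OF small]] w nbrs_subset by blast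
    fix A assume A: "A \<subseteq> V" "clique A \<and> card A = p"
    show "A \<inter> insert w (S - {v}) \<noteq> {}"
    proof
      assume disj: "A \<inter> insert w (S - {v}) = {}"
      have "A \<inter> S \<noteq> {}"
        using smallest_hittingD[OF small] A unfolding hitting_def by blast
      then have "v \<in> A"
        using disj by blast
      have "A - {v} \<subseteq> nbrs v - S - {w}"
        using disj cliqueD[of A v] A \<open>v \<in> A\<close> by blast
      then have "card (A - {v}) \<le> card (nbrs v - S - {w})"
        by (intro card_mono) auto
      moreover have "card (A - {v}) = p - 1"
        using A \<open>v \<in> A\<close> finite_subset[OF _ finite_V] by simp
      moreover have "card (nbrs v - S - {w}) < p - 1"
        using degree_within_smallest(2)[OF small v full] w card_Diff1_less[of "nbrs v - S" w] by simp
      ultimately show False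
        by simp
    qed
  qed
  moreover have "card (insert w (S - {v})) = card S"
    using v w hitting_finite[OF smallest_hittingD[OF small]]
    by (metis DiffD2 Diff_iff card.remove card_insert_disjoint finite_Diff)
  ultimately show ?thesis
    using small unfolding smallest_hitting_def by simp
qed

lemma cost_insert:
  assumes "finite T" "z \<notin> T" "card (nbrs z \<inter> T) = d"
  shows "cost (insert z T) = (Suc (card T), num_cliques 2 T + d,
    excess T + (int (num_cliques (q - 1) (nbrs z \<inter> T)) - (int q - 2) * int (num_cliques q (nbrs z \<inter> T))))"
proof -
  have q: "q = Suc (q - 1)"
    using two_le_q by simp
  have 2: "num_cliques 2 (insert z T) = num_cliques 2 T + d"
    using num_cliques_insert[OF assms(1,2), of "Suc 0"] assms(3) by (simp add: numeral_2_eq_2)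
  have "num_cliques q (insert z T) = num_cliques q T + num_cliques (q - 1) (nbrs z \<inter> T)"
    using num_cliques_insert[OF assms(1,2), of "q - 1"] q by simp
  moreover have "num_cliques (Suc q) (insert z T) = num_cliques (Suc q) T + num_cliques q (nbrs z \<inter> T)"
    using num_cliques_insert[OF assms(1,2)] .
  ultimately show ?thesis
    using 2 assms(1,2) by (simp add: cost_def excess_def algebra_simps)
qed

text \<open>
  Both sets arise from \<open>S - {v}\<close> by adding one vertex, so their costs differ only through the
  neighbourhoods of \<open>v\<close> and \<open>w\<close> in \<open>S - {v}\<close>. Minimality in the second component gives \<open>w\<close> at least \<open>q\<close>
  neighbours there, minimality in the third makes them a near-clique, and then the costs are equal. The
  last claim says that \<open>v\<close> and \<open>w\<close> swap their roles in the \<open>p\<close>-clique \<open>insert v (nbrs v - S)\<close>.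
\<close>
lemma core_exchange:
  assumes opt: "optimal S" and core: "core S v" and w: "w \<in> nbrs v - S"
  shows "optimal (insert w (S - {v}))"
    and "core (insert w (S - {v})) w"
    and "nbrs w - insert w (S - {v}) = insert v (nbrs v - S) - {w}"
proof -
  let ?T = "S - {v}" and ?S' = "insert w (S - {v})"
  have v: "v \<in> S" and full: "card (nbrs v \<inter> S) = q" and near: "near_clique (nbrs v \<inter> S)"
    using core unfolding core_def by auto
  note small = optimal_smallest[OF opt]
  have fin: "finite ?T"
    using hitting_finite[OF smallest_hittingD[OF small]] by auto
  have K: "clique (nbrs v - S)" "card (nbrs v - S) = p - 1"
    using degree_within_smallest(2)[OF small v full] by auto
  have small': "smallest_hitting ?S'"
    by (rule smallest_hitting_exchange[OF small v full w])
  have nT: "nbrs v \<inter> ?T = nbrs v \<inter> S" and nT': "nbrs w \<inter> ?S' = nbrs w \<inter> ?T"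
    by auto
  have S_eq: "insert v ?T = S"
    using v by blast
  define D where "D = nbrs w \<inter> ?T"
  define g where "g E = int (num_cliques (q - 1) E) - (int q - 2) * int (num_cliques q E)" for E
  have costS: "cost S = (Suc (card ?T), num_cliques 2 ?T + q, excess ?T + g (nbrs v \<inter> S))"
    using cost_insert[OF fin, of v q] full unfolding S_eq nT g_def by simp
  have costS': "cost ?S' = (Suc (card ?T), num_cliques 2 ?T + card D, excess ?T + g D)"
    using cost_insert[OF fin, of w "card D"] w unfolding g_def D_def by simp
  have g2: "(g E = 2 \<longleftrightarrow> near_clique E) \<and> g E \<le> 2" if "card E = q" "finite E" for E
  proof -
    have "Suc (q - 1) = q" "int (q - 1) - 1 = int q - 2"
      using two_le_q by auto
    then show ?thesis
      using num_cliques_near[of E "q - 1"] that two_le_q unfolding g_def by simp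
  qed
  have le: "cost S \<le> cost ?S'"
    using opt smallest_hittingD[OF small'] unfolding optimal_def by blast
  then have "q \<le> card D"
    unfolding costS costS' by auto
  moreover have "card D \<le> q"
    using degree_within_smallest(1)[OF small', of w] unfolding nT' D_def by simp
  ultimately have cD: "card D = q"
    by simp
  have "2 \<le> g D"
    using le cD g2[of "nbrs v \<inter> S"] full near unfolding costS costS' by auto
  then have near': "near_clique D" and "g D = 2"
    using g2[OF cD] unfolding D_def by auto
  then have "cost ?S' = cost S"
    unfolding costS costS' using cD g2[of "nbrs v \<inter> S"] full near by auto
  then show "optimal ?S'"
    using opt smallest_hittingD[OF small'] unfolding optimal_def by simp
  show "core ?S' w"
    using cD near' unfolding core_def nT' D_def by simp
  have "insert v (nbrs v - S) - {w} \<subseteq> nbrs w - ?S'"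
    using cliqueD[OF K(1)] w v nbrs_sym[of w v] by auto
  moreover have "card (insert v (nbrs v - S) - {w}) = p - 1"
    using K(2) w by (simp add: card_Diff_singleton)
  moreover have "card (nbrs w - ?S') = p - 1"
    using degree_within_smallest(2)[OF small', of w] cD unfolding nT' D_def by simp
  ultimately show "nbrs w - ?S' = insert v (nbrs v - S) - {w}"
    using card_subset_eq[of "nbrs w - ?S'"] by auto
qed

lemma core_full:
  assumes "optimal S" "core S v"
  shows "v \<in> S" "card (nbrs v \<inter> S) = q" "near_clique (nbrs v \<inter> S)"
    and "clique (nbrs v - S)" "card (nbrs v - S) = p - 1"
  using assms degree_within_smallest(2)[OF optimal_smallest[OF assms(1)], of v]
  unfolding core_def by auto

text \<open>
  In other words, \<open>nbrs v - S\<close> is a connected component of the graph induced on the complement of \<open>S\<close>.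
\<close>
lemma exchange_clique_component:
  assumes "optimal S" "core S v" "z \<in> nbrs v - S"
  shows "nbrs z - S = nbrs v - S - {z}"
proof -
  have "v \<in> S"
    using core_full(1)[OF assms(1,2)] .
  then have "nbrs z - S = nbrs z - insert z (S - {v}) - {v}"
    by auto
  also have "\<dots> = nbrs v - S - {z}"
    unfolding core_exchange(3)[OF assms] by auto
  finally show ?thesis .
qed

lemma dominating_neighbour_core:
  assumes opt: "optimal S" and core: "core S v"
    and u: "u \<in> nbrs v \<inter> S" "nbrs v \<inter> S - {u} \<subseteq> nbrs u"
  shows "nbrs u \<inter> S = insert v (nbrs v \<inter> S - {u})" and "core S u"
proof -
  note C = core_full[OF opt core]
  let ?E = "insert v (nbrs v \<inter> S - {u})"
  have sub: "?E \<subseteq> nbrs u \<inter> S"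
    using u C(1) nbrs_sym[of u v] by auto
  have cE: "card ?E = q"
    using C(2) u(1) two_le_q by simp
  show eq: "nbrs u \<inter> S = ?E"
    using card_seteq[OF _ sub] cE degree_within_smallest(1)[OF optimal_smallest[OF opt], of u] u(1)
    by auto
  have "near_clique (insert v (nbrs v \<inter> S - {u}))"
  proof -
    obtain c d where *: "\<And>x y. x \<in> nbrs v \<inter> S \<Longrightarrow> y \<in> nbrs v \<inter> S \<Longrightarrow> x \<noteq> y \<Longrightarrow> adj x y \<or> {x, y} = {c, d}"
      using C(3) unfolding near_clique_def by blast
    have "adj x y \<or> {x, y} = {c, d}" if "x \<in> ?E" "y \<in> ?E" "x \<noteq> y" for x y
      using that * adj_sym unfolding nbrs_def by auto
    then show ?thesis
      unfolding near_clique_def by blast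
  qed
  then show "core S u"
    using u(1) eq cE unfolding core_def by simp
qed

text \<open>
  As \<open>u\<close> is itself a core vertex, its outer neighbours form a clique; as \<open>nbrs v - S\<close> is a component of
  the complement, a clique that touches it lies inside it.
\<close>
lemma dominating_neighbour_same_clique:
  assumes opt: "optimal S" and core: "core S v"
    and u: "u \<in> nbrs v \<inter> S" "nbrs v \<inter> S - {u} \<subseteq> nbrs u"
    and z: "z \<in> nbrs u \<inter> (nbrs v - S)"
  shows "nbrs u - S = nbrs v - S"
proof -
  have u': "core S u"
    using dominating_neighbour_core(2)[OF opt core u] .
  have "nbrs u - S \<subseteq> nbrs v - S"
  proof
    fix y assume y: "y \<in> nbrs u - S"
    show "y \<in> nbrs v - S"
    proof (cases "y = z")
      case False
      then have "y \<in> nbrs z - S"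
        using cliqueD[OF core_full(4)[OF opt u'], of z y] y z by auto
      then show ?thesis
        using exchange_clique_component[OF opt core, of z] z by auto
    qed (use z in auto)
  qed
  then show ?thesis
    using card_subset_eq[of "nbrs v - S" "nbrs u - S"] core_full(5)[OF opt u'] core_full(5)[OF opt core]
    by simp
qed

lemma no_large_clique:
  assumes "X \<subseteq> V" "near_clique X" "card X + 1 \<ge> p + q"
  shows False
proof -
  have "p + q - 1 \<le> card X"
    using assms(3) by simp
  then obtain Y where "Y \<subseteq> X" "card Y = p + q - 1"
    by (rule obtain_subset_with_card_n)
  then show False
    using no_near_clique[of Y] near_clique_mono[OF assms(2)] assms(1) two_le_p by auto
qed

text \<open>
  Suppose that \<open>u\<close> has a neighbour in \<open>K = nbrs v - S\<close>. Then \<open>u\<close> is adjacent to all of \<open>K\<close>. If every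
  \<open>z \<in> K\<close> has the same neighbours \<open>D\<close> in \<open>S - {v}\<close> as \<open>v\<close>, then \<open>K \<union> D\<close> is a near-clique that is too
  large. Otherwise some \<open>z\<close> has another neighbourhood \<open>E\<close>, which contains \<open>u\<close> and one vertex \<open>d\<close> that is
  not adjacent to \<open>u\<close>. This is the only edge missing in \<open>E\<close>, so the remaining vertices of \<open>E\<close> dominate
  \<open>E\<close>, and the preceding lemma, applied after exchanging \<open>v\<close> for \<open>z\<close>, joins them to all of \<open>insert v K\<close>.
  Now \<open>E - {d}\<close> and \<open>insert v K\<close> together are a clique that is too large.
\<close>
lemma dominating_neighbour_private:
  assumes opt: "optimal S" and core: "core S v"
    and u: "u \<in> nbrs v \<inter> S" "nbrs v \<inter> S - {u} \<subseteq> nbrs u"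
  shows "nbrs u \<inter> (nbrs v - S) = {}"
proof (rule ccontr)
  assume "nbrs u \<inter> (nbrs v - S) \<noteq> {}"
  then obtain z0 where "z0 \<in> nbrs u \<inter> (nbrs v - S)"
    by blast
  then have uK: "nbrs u - S = nbrs v - S"
    using dominating_neighbour_same_clique[OF opt core u] by blast
  note C = core_full[OF opt core]
  define D where "D = nbrs v \<inter> S"
  define K where "K = nbrs v - S"
  have uS: "u \<in> S" "u \<noteq> v" "v \<in> nbrs u"
    using u nbrs_sym[of u v] by auto
  have Nu: "nbrs u \<inter> S = insert v (D - {u})"
    using dominating_neighbour_core(1)[OF opt core u] unfolding D_def .
  have finD: "finite D" "finite K"
    unfolding D_def K_def by auto
  have inV: "D \<subseteq> V" "K \<subseteq> V" "v \<in> V"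
    using nbrs_subset C(1) hitting_subset[OF smallest_hittingD[OF optimal_smallest[OF opt]]]
    unfolding D_def K_def by auto
  have K: "clique K" "card K = p - 1"
    using C unfolding K_def by auto
  have vK: "v \<notin> K" "v \<notin> D" "D \<inter> K = {}"
    unfolding D_def K_def by auto
  show False
  proof (cases "\<forall>z\<in>K. nbrs z \<inter> (S - {v}) = D")
    case True
    obtain c d where *: "\<And>x y. x \<in> D \<Longrightarrow> y \<in> D \<Longrightarrow> x \<noteq> y \<Longrightarrow> adj x y \<or> {x, y} = {c, d}"
      using C(3) unfolding near_clique_def D_def by blast
    have DK: "adj x y" "adj y x" if "x \<in> K" "y \<in> D" for x y
    proof -
      have "y \<in> nbrs x"
        using True that by blast
      then show "adj x y" "adj y x"
        unfolding nbrs_def using adj_sym by auto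
    qed
    have KK: "adj x y" if "x \<in> K" "y \<in> K" "x \<noteq> y" for x y
      using K(1) that unfolding clique_def by blast
    have "adj x y \<or> {x, y} = {c, d}" if "x \<in> K \<union> D" "y \<in> K \<union> D" "x \<noteq> y" for x y
      using that DK KK * by blast
    then have "near_clique (K \<union> D)"
      unfolding near_clique_def by blast
    moreover have "card (K \<union> D) = p - 1 + q"
      using K(2) C(2) vK(3) finD unfolding D_def[symmetric] by (subst card_Un_disjoint) auto
    ultimately show False
      using no_large_clique[of "K \<union> D"] inV two_le_p by auto
  next
    case False
    then obtain z where z: "z \<in> K" "nbrs z \<inter> (S - {v}) \<noteq> D"
      by blast
    define S' where "S' = insert z (S - {v})"
    define E where "E = nbrs z \<inter> (S - {v})"
    have ex: "optimal S'" "core S' z" "nbrs z - S' = insert v K - {z}"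
      using core_exchange[OF opt core, of z] z(1) unfolding S'_def K_def by auto
    note C' = core_full[OF ex(1,2)]
    have E: "nbrs z \<inter> S' = E"
      unfolding S'_def E_def by auto
    have uE: "u \<in> E"
      using uS z(1) uK nbrs_sym[of u z] unfolding E_def K_def by auto
    have "\<not> E \<subseteq> D"
      using card_subset_eq[OF finD(1), of E] z(2) C(2) C'(2) E unfolding D_def E_def by auto
    then obtain d where d: "d \<in> E" "d \<notin> D"
      by blast
    have ud: "u \<noteq> d" "d \<notin> nbrs u"
      using d u(1) Nu unfolding D_def E_def by auto
    have adjE: "y \<in> nbrs x" if "x \<in> E" "y \<in> E" "x \<noteq> y" "{x, y} \<noteq> {u, d}" for x y
      using near_clique_nonadjacent[OF C'(3), of u d x y] that uE d ud unfolding E by auto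
    have ED: "x \<in> D" if "x \<in> E" "x \<noteq> d" for x
    proof (cases "x = u")
      case False
      then have "x \<in> nbrs u \<inter> S"
        using adjE[of u x] that uE unfolding E_def by (auto simp: doubleton_eq_iff)
      then show ?thesis
        using Nu that unfolding E_def by auto
    qed (use u D_def in auto)
    have joined: "insert v K \<subseteq> nbrs x" if x: "x \<in> E" "x \<noteq> d" for x
    proof (cases "x = u")
      case True
      then show ?thesis
        using uK uS unfolding K_def by auto
    next
      case False
      have dom: "nbrs z \<inter> S' - {x} \<subseteq> nbrs x"
        using adjE[of x] x(1,2) False unfolding E by (auto simp: doubleton_eq_iff)
      have "v \<in> nbrs x \<inter> (nbrs z - S')"
        using ED[OF x] vK z(1) nbrs_sym[of x v] unfolding ex(3) D_def by auto
      then have "nbrs x - S' = insert v K - {z}"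
        using dominating_neighbour_same_clique[OF ex(1,2) _ dom, of v] x(1) unfolding E ex(3) by auto
      moreover have "z \<in> nbrs x"
        using x(1) nbrs_sym[of x z] unfolding E_def by auto
      ultimately show ?thesis
        by blast
    qed
    have "clique (E - {d} \<union> insert v K)"
    proof (rule cliqueI)
      fix x y assume xy: "x \<in> E - {d} \<union> insert v K" "y \<in> E - {d} \<union> insert v K" "x \<noteq> y"
      have "clique (insert v K)"
        using K(1) unfolding clique_insert K_def by blast
      then show "y \<in> nbrs x"
        using xy adjE[of x y] joined[of x] joined[of y] cliqueD[of "insert v K" x y] nbrs_sym[of x y]
        by (auto simp: doubleton_eq_iff)
    qed
    moreover have "card (E - {d} \<union> insert v K) = (q - 1) + p"
    proof -
      have "card (E - {d}) = q - 1"
        using C'(2) d(1) unfolding E by simp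
      moreover have "card (insert v K) = p"
        using K(2) vK(1) finD(2) two_le_p by simp
      moreover have "(E - {d}) \<inter> insert v K = {}"
        unfolding E_def K_def by auto
      moreover have "finite E"
        unfolding E_def by simp
      ultimately show ?thesis
        using finD(2) by (subst card_Un_disjoint) simp_all
    qed
    moreover have "E - {d} \<union> insert v K \<subseteq> V"
      using inV nbrs_subset unfolding E_def by auto
    ultimately show False
      using no_large_clique[of "E - {d} \<union> insert v K"] clique_near_clique two_le_q by auto
  qed
qed

section \<open>Walks of exchanges\<close>

text \<open>
  The clause for \<open>q = 3\<close> keeps the walk from being led back to the clique of \<open>v\<close>. For larger \<open>q\<close> the
  number of dominating vertices in a near-clique on \<open>q\<close> vertices does this.
\<close>
definition exit_from :: "'v set \<Rightarrow> 'v \<Rightarrow> 'v \<Rightarrow> bool" where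
  "exit_from S v w \<longleftrightarrow> optimal S \<and> core S v \<and> w \<in> nbrs v - S \<and>
     (q = 3 \<longrightarrow> (\<forall>b\<in>nbrs v \<inter> S. nbrs b \<inter> (nbrs v - S) \<noteq> {w}))"

text \<open>
  For \<open>q = 3\<close> the clique \<open>nbrs v - S\<close> has \<open>p - 1 \<ge> 4\<close> vertices, while each of the three neighbours of
  \<open>v\<close> in \<open>S\<close> rules out at most one choice of \<open>w\<close>.
\<close>
lemma exit_exists:
  assumes opt: "optimal S" and core: "core S v" and large: "p + q \<ge> 8"
  shows "\<exists>w. exit_from S v w"
proof -
  note C = core_full[OF opt core]
  let ?D = "nbrs v \<inter> S" and ?K = "nbrs v - S"
  have "\<exists>w\<in>?K. q = 3 \<longrightarrow> (\<forall>b\<in>?D. nbrs b \<inter> ?K \<noteq> {w})"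
  proof (rule ccontr)
    assume *: "\<not> ?thesis"
    have "?K \<noteq> {}"
      using C(5) two_le_p by force
    then have "q = 3"
      using * by blast
    have "?K \<subseteq> (\<lambda>b. the_elem (nbrs b \<inter> ?K)) ` ?D"
    proof
      fix w assume "w \<in> ?K"
      then obtain b where b: "b \<in> ?D" "nbrs b \<inter> ?K = {w}"
        using * by blast
      then have "w = the_elem (nbrs b \<inter> ?K)"
        by simp
      then show "w \<in> (\<lambda>b. the_elem (nbrs b \<inter> ?K)) ` ?D"
        using b(1) by blast
    qed
    then have "card ?K \<le> card ?D"
      by (rule surj_card_le[rotated]) simp
    then show False
      using C(2,5) \<open>q = 3\<close> large by simp
  qed
  then show ?thesis
    using opt core unfolding exit_from_def by blast
qed

definition walk :: "(nat \<Rightarrow> 'v set) \<Rightarrow> (nat \<Rightarrow> 'v) \<Rightarrow> (nat \<Rightarrow> 'v) \<Rightarrow> bool" where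
  "walk S v w \<longleftrightarrow> (\<forall>n. exit_from (S n) (v n) (w n) \<and> S (Suc n) = insert (w n) (S n - {v n}) \<and>
     v (Suc n) \<in> nbrs (w n) \<inter> S (Suc n) \<and>
     nbrs (w n) \<inter> S (Suc n) - {v (Suc n)} \<subseteq> nbrs (v (Suc n)))"

text \<open>
  The near-clique around \<open>w\<close> has \<open>q \<ge> 3\<close> vertices, so some vertex in it avoids the missing edge; it
  dominates the near-clique and is the next core vertex.
\<close>
lemma walk_exists:
  assumes "optimal S0" "core S0 v0" and large: "p + q \<ge> 8" and q: "3 \<le> q"
  shows "\<exists>S v w. walk S v w"
proof -
  let ?P = "\<lambda>s. case s of (S, v, w) \<Rightarrow> exit_from S v w"
  let ?Q = "\<lambda>s s'. case (s, s') of ((S, v, w), (S', v', w')) \<Rightarrow>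
    S' = insert w (S - {v}) \<and> v' \<in> nbrs w \<inter> S' \<and> nbrs w \<inter> S' - {v'} \<subseteq> nbrs v'"
  have "\<exists>f. \<forall>n. ?P (f n) \<and> ?Q (f n) (f (Suc n))"
  proof (rule dependent_nat_choice)
    show "\<exists>s. ?P s"
      using exit_exists[OF assms(1,2) large] by auto
  next
    fix s :: "'v set \<times> 'v \<times> 'v" and n :: nat
    assume P: "?P s"
    obtain S v w where s: "s = (S, v, w)"
      by (cases s)
    define S' where "S' = insert w (S - {v})"
    have ex: "optimal S'" "core S' w"
      using P core_exchange unfolding s exit_from_def S'_def by auto
    note C' = core_full[OF ex]
    obtain u where u: "u \<in> nbrs w \<inter> S'" "nbrs w \<inter> S' - {u} \<subseteq> nbrs u"
      using near_clique_dominating[OF C'(3)] C'(2) q by auto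
    obtain w' where "exit_from S' u w'"
      using exit_exists[OF ex(1) dominating_neighbour_core(2)[OF ex u] large] by blast
    then have "?P (S', u, w') \<and> ?Q s (S', u, w')"
      using u unfolding s S'_def by simp
    then show "\<exists>t. ?P t \<and> ?Q s t"
      by blast
  qed
  then obtain f where f: "\<forall>n. ?P (f n) \<and> ?Q (f n) (f (Suc n))" ..
  have "walk (\<lambda>n. fst (f n)) (\<lambda>n. fst (snd (f n))) (\<lambda>n. snd (snd (f n)))"
    unfolding walk_def
  proof
    fix n
    show "exit_from (fst (f n)) (fst (snd (f n))) (snd (snd (f n))) \<and>
      fst (f (Suc n)) = insert (snd (snd (f n))) (fst (f n) - {fst (snd (f n))}) \<and>
      fst (snd (f (Suc n))) \<in> nbrs (snd (snd (f n))) \<inter> fst (f (Suc n)) \<and>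
      nbrs (snd (snd (f n))) \<inter> fst (f (Suc n)) - {fst (snd (f (Suc n)))}
        \<subseteq> nbrs (fst (snd (f (Suc n))))"
      using f[rule_format, of n] unfolding case_prod_beta fst_conv snd_conv .
  qed
  then show ?thesis
    by blast
qed

lemma two_dominating_contra:
  assumes "near_clique (insert w D - {t})" "w \<notin> D" "t \<noteq> w"
    and "y1 \<in> D - {t}" "y2 \<in> D - {t}" "y1 \<noteq> y2" "w \<notin> nbrs y1" "w \<notin> nbrs y2"
  shows False
proof -
  have "y1 \<noteq> w" "y2 \<noteq> w" "{y2, w} \<noteq> {y1, w}"
    using assms by (auto simp: doubleton_eq_iff)
  then have "w \<in> nbrs y2"
    using near_clique_nonadjacent[OF assms(1), of y1 w y2 w] assms(3-7) by simp
  then show False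
    using assms(8) by contradiction
qed

text \<open>
  The set \<open>A = nbrs (w i) - S (Suc i)\<close> is the clique left behind in step \<open>i\<close>, with \<open>v i\<close> in the place of
  \<open>w i\<close>. If step \<open>j\<close> took a vertex out of it, then \<open>A\<close> would be the outer clique of \<open>v j\<close>; so \<open>v i\<close>
  would be adjacent to \<open>v j\<close>, and its neighbours in \<open>S j\<close> would be its old neighbours \<open>D\<close> together with
  \<open>w i\<close>. If \<open>v j = w i\<close>, then the near-clique found around \<open>w i\<close> would still be complete, although
  \<open>v (Suc i)\<close> has been removed from it. If \<open>v j \<in> D\<close>, then \<open>D - {v j}\<close> together with \<open>w i\<close> is a
  near-clique; but by privacy \<open>w i\<close> is not adjacent to any vertex that dominates \<open>D\<close>, so there is at most
  one such vertex in \<open>D - {v j}\<close>. Counting leaves only \<open>q = 3\<close>, where the condition on \<open>w i\<close> in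
  \<open>exit_from\<close> gives the contradiction.
\<close>
lemma walk_never_returns:
  assumes W: "walk S v w" and large: "p + q \<ge> 8" and q: "3 \<le> q" and ij: "i < j"
    and past: "\<And>k. k < j \<Longrightarrow> (nbrs (w k) - S (Suc k)) \<inter> S j = {}"
  shows "w j \<notin> nbrs (w i) - S (Suc i)"
proof
  assume ret: "w j \<in> nbrs (w i) - S (Suc i)"
  have ex: "optimal (S n)" "core (S n) (v n)" "w n \<in> nbrs (v n) - S n" for n
    using W unfolding walk_def exit_from_def by auto
  have step: "S (Suc n) = insert (w n) (S n - {v n})" "v (Suc n) \<in> nbrs (w n) \<inter> S (Suc n)" for n
    using W unfolding walk_def by blast+
  have ex': "core (S (Suc n)) (w n)"
    and A_eq: "nbrs (w n) - S (Suc n) = insert (v n) (nbrs (v n) - S n) - {w n}" for n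
    using core_exchange(2,3)[OF ex] step(1) by simp_all
  note C = core_full[OF ex(1,2)]
  note C' = core_full[OF ex(1) ex']
  define K where "K n = nbrs (v n) - S n" for n
  define A where "A = insert (v i) (K i) - {w i}"
  define D where "D = nbrs (v i) \<inter> S i"
  have vA: "v i \<in> A"
    using ex(3)[of i] unfolding A_def by auto
  have finK: "finite (K n)" for n
    unfolding K_def by simp
  have AS: "A \<inter> S j = {}"
    using past[OF ij] unfolding A_eq A_def K_def .
  have A_clique: "clique A" "card A = p - 1"
    using C'(4,5)[of i] unfolding A_eq A_def K_def by auto
  have "A \<subseteq> K j"
  proof
    fix x assume x: "x \<in> A"
    have "w j \<in> A"
      using ret unfolding A_eq A_def K_def .
    show "x \<in> K j"
    proof (cases "x = w j")
      case False
      then have "x \<in> nbrs (w j) - S j"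
        using cliqueD[OF A_clique(1) \<open>w j \<in> A\<close> x] x AS by auto
      then show ?thesis
        using exchange_clique_component[OF ex[of j]] unfolding K_def by auto
    qed (use ex(3)[of j] K_def in auto)
  qed
  then have AK: "K j = A"
    using card_subset_eq[OF finK, of A j] A_clique(2) C(5)[of j] unfolding K_def by auto
  define S' where "S' = insert (v i) (S j - {v j})"
  have vK: "v i \<in> nbrs (v j) - S j"
    using vA AK unfolding K_def by auto
  have opt': "optimal S'" and core': "core S' (v i)"
    and K': "nbrs (v i) - S' = insert (v j) (K j) - {v i}"
    using core_exchange[OF ex(1,2)[of j] vK] unfolding S'_def K_def by auto
  note C'' = core_full[OF opt' core']
  have vj: "v j \<in> nbrs (v i) \<inter> S j"
    using vK nbrs_sym[of "v i" "v j"] C(1)[of j] by auto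
  have wD: "w i \<notin> D" "finite D" "card D = q"
    using ex(3)[of i] C(2)[of i] unfolding D_def by auto
  have sub: "nbrs (v i) \<inter> S j \<subseteq> insert (w i) D"
    using AS unfolding A_def K_def D_def by auto
  have E_eq: "nbrs (v i) \<inter> S' = nbrs (v i) \<inter> S j - {v j}"
    unfolding S'_def by auto
  have "card (nbrs (v i) \<inter> S j) = Suc q"
    using C''(2) vj card_Suc_Diff1[OF _ vj] unfolding E_eq by simp
  then have Nvi: "nbrs (v i) \<inter> S j = insert (w i) D"
    using card_subset_eq[OF _ sub] wD by simp
  have near: "near_clique (insert (w i) D - {v j})"
    using C''(3) unfolding E_eq Nvi .
  show False
  proof (cases "v j = w i")
    case True
    have sub': "nbrs (w i) \<inter> S j \<subseteq> nbrs (w i) \<inter> S (Suc i)"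
      using past[OF ij] by blast
    have "nbrs (w i) \<inter> S j = nbrs (w i) \<inter> S (Suc i)"
      using card_subset_eq[OF _ sub'] C(2)[of j] C'(2)[of i] True by simp
    then have in_j: "v (Suc i) \<in> S j"
      using step(2)[of i] by blast
    show False
    proof (cases "j = Suc i")
      case True
      then show False
        using \<open>v j = w i\<close> step(2)[of i] by auto
    next
      case False
      then have "Suc i < j"
        using ij by simp
      moreover have "v (Suc i) \<in> nbrs (w (Suc i)) - S (Suc (Suc i))"
        using ex(3)[of "Suc i"] unfolding A_eq by auto
      ultimately show False
        using past[of "Suc i"] in_j by blast
    qed
  next
    case False
    then have vjD: "v j \<in> D"
      using vj Nvi by auto
    have priv: "nbrs y \<inter> K i = {}" if "y \<in> D" "D - {y} \<subseteq> nbrs y" for y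
      using dominating_neighbour_private[OF ex(1,2), of y i] that unfolding D_def K_def by auto
    have private_w: "w i \<notin> nbrs y" if "y \<in> D" "D - {y} \<subseteq> nbrs y" for y
      using priv[OF that] ex(3)[of i] unfolding K_def by auto
    have uniq: "y1 = y2" if "y1 \<in> D - {v j}" "D - {y1} \<subseteq> nbrs y1" "y2 \<in> D - {v j}" "D - {y2} \<subseteq> nbrs y2"
      for y1 y2
      using two_dominating_contra[OF near wD(1) False that(1,3)] private_w that by auto
    obtain c d where cd: "\<And>x y. x \<in> D \<Longrightarrow> y \<in> D \<Longrightarrow> x \<noteq> y \<Longrightarrow> adj x y \<or> {x, y} = {c, d}"
      using C(3)[of i] unfolding near_clique_def D_def by blast
    have dom: "D - {y} \<subseteq> nbrs y" if "y \<in> D - {c, d}" for y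
      using cd[of y] that unfolding nbrs_def by blast
    have few: "card (D - {c, d} - {v j}) \<le> 1"
      using uniq dom wD(2) by (subst card_le_Suc0_iff_eq[simplified One_nat_def[symmetric]]) auto
    have "2 \<ge> card {c, d}"
      by (simp add: card_insert_if)
    then have Dcd: "card (D - {c, d}) \<ge> q - 2"
      using diff_card_le_card_Diff[of "{c, d}" D] wD(3) by simp
    have q3: "q = 3 \<and> v j \<in> {c, d}"
    \<comment> \<open>If \<open>v j\<close> dominates \<open>D\<close>, privacy leaves \<open>K i\<close> the single vertex \<open>w i\<close>. So \<open>p = 2\<close> and \<open>q \<ge> 6\<close>,
      which is too many for \<open>few\<close>.\<close>
    proof (cases "v j \<in> {c, d}")
      case True
      then have "D - {c, d} - {v j} = D - {c, d}"
        by auto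
      then show ?thesis
        using few Dcd True q by simp
    next
      case out: False
      have "nbrs (v j) \<inter> K i = {}"
        using priv[OF vjD] dom vjD out by blast
      moreover have "K i - {w i} \<subseteq> nbrs (v j)"
        using AK unfolding A_def K_def by auto
      ultimately have "K i \<subseteq> {w i}"
        by blast
      then have "card (K i) \<le> 1"
        using card_mono[of "{w i}" "K i"] by simp
      then have "q \<ge> 6"
        using C(5)[of i] large unfolding K_def by simp
      moreover have "card (D - {c, d} - {v j}) \<ge> q - 3"
        using Dcd wD(2) vjD out by (simp add: card_Diff_singleton)
      ultimately show ?thesis
        using few by simp
    qed
    have "D - {c, d} \<noteq> {}"
      using Dcd q by force
    then obtain y where y: "y \<in> D" "y \<notin> {c, d}"
      by blast
    have yvj: "y \<noteq> v j"
      using y q3 by blast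
    have "card (D - {y} - {v j}) = 1"
      using wD q3 y yvj vjD by (simp add: card_Diff_singleton)
    then obtain b where b: "D - {y} - {v j} = {b}"
      by (auto simp: card_1_singleton_iff)
    then have bD: "b \<in> D" "b \<noteq> y" "b \<noteq> v j"
      by blast+
    have "D = {y, v j, b}"
      using b y(1) vjD by blast
    then have E3: "insert (w i) D - {v j} = {y, b, w i}"
      using False yvj bD by auto
    \<comment> \<open>The missing edge of this triple is \<open>{y, w i}\<close>, so \<open>b\<close> dominates it.
      Privacy for the core vertex \<open>v i\<close> of \<open>S'\<close> shows that \<open>w i\<close> is its only neighbour in \<open>K i\<close>, which \<open>exit_from\<close> excludes.\<close>
    have b_adj: "{y, w i} \<subseteq> nbrs b"
    proof -
      have "w i \<notin> nbrs y"
        using private_w[OF y(1)] dom y by blast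
      then show ?thesis
        using near_clique_nonadjacent[OF near[unfolded E3], of y "w i" b] bD wD(1) y(1)
        by (auto simp: doubleton_eq_iff)
    qed
    have "nbrs b \<inter> (nbrs (v i) - S') = {}"
      by (rule dominating_neighbour_private[OF opt' core'])
        (use b_adj E_eq E3 Nvi in auto)
    moreover have "K i - {w i} \<subseteq> nbrs (v i) - S'"
    proof -
      have "v i \<notin> K i"
        unfolding K_def by simp
      then show ?thesis
        unfolding K' AK A_def by auto
    qed
    ultimately have "nbrs b \<inter> K i = {w i}"
      using b_adj ex(3)[of i] unfolding K_def by blast
    moreover have "exit_from (S i) (v i) (w i)"
      using W unfolding walk_def by blast
    ultimately show False
      using q3 bD(1) unfolding exit_from_def D_def K_def by blast
  qed
qed

text \<open>
  By the preceding lemma \<open>v i\<close> stays outside all later sets \<open>S j\<close>, while \<open>v j \<in> S j\<close>. So the vertices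
  \<open>v i\<close> are pairwise distinct.
\<close>
theorem optimal_no_core:
  assumes opt: "optimal S" and large: "p + q \<ge> 8" and q: "3 \<le> q"
  shows "\<not> core S v"
proof
  assume "core S v"
  then obtain S v w where W: "walk S v w"
    using walk_exists[OF opt _ large q] by blast
  have ex: "optimal (S n)" "core (S n) (v n)" "w n \<in> nbrs (v n) - S n"
    and step: "S (Suc n) = insert (w n) (S n - {v n})" for n
    using W unfolding walk_def exit_from_def by auto
  have gone: "(nbrs (w i) - S (Suc i)) \<inter> S j = {}" if "i < j" for i j
    using that
  proof (induction j arbitrary: i)
    case (Suc j)
    show ?case
    proof (cases "i = j")
      case False
      then have "i < j"
        using Suc.prems by simp
      then have "(nbrs (w i) - S (Suc i)) \<inter> S j = {}"
        by (rule Suc.IH)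
      moreover have "w j \<notin> nbrs (w i) - S (Suc i)"
        using walk_never_returns[OF W large q \<open>i < j\<close>] Suc.IH by blast
      moreover have "S (Suc j) \<subseteq> insert (w j) (S j)"
        unfolding step[of j] by blast
      ultimately show ?thesis
        by blast
    qed auto
  qed simp
  have "v i \<noteq> v j" if "i < j" for i j
  proof -
    have "v i \<in> nbrs (w i) - S (Suc i)"
      unfolding step core_exchange(3)[OF ex] using ex(3)[of i] by auto
    moreover have "v j \<in> S j"
      using core_full(1)[OF ex(1,2)] .
    ultimately show ?thesis
      using gone[OF that] by auto
  qed
  then have "inj v"
    by (intro linorder_injI) blast
  moreover have "range v \<subseteq> V"
    using core_full(1)[OF ex(1,2)] hitting_subset[OF smallest_hittingD[OF optimal_smallest[OF ex(1)]]]
    by blast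
  ultimately show False
    using finite_subset[OF _ finite_V] range_inj_infinite by blast
qed

end

section \<open>Transversals of small induced degree\<close>

text \<open>
  Induction on the number of classes. Let \<open>a\<close> and \<open>b\<close> be two vertices of the class \<open>X\<close>. If they lie in
  different forbidden sets \<open>ma\<close> and \<open>mb\<close>, merge these into the single forbidden set
  \<open>(ma - {a}) \<union> (mb - {b})\<close>: a transversal of the other classes that does not contain the merged set leaves
  \<open>a\<close> or \<open>b\<close> free to be chosen. In the remaining cases one of the two can always be chosen.
\<close>
lemma transversal_avoiding:
  assumes "finite P" "disjoint P" "\<forall>X\<in>P. 2 \<le> card X"
    and "disjoint M" "\<forall>m\<in>M. 2 \<le> card m"
  shows "\<exists>T\<subseteq>\<Union>P. (\<forall>X\<in>P. \<exists>x. T \<inter> X = {x}) \<and> (\<forall>m\<in>M. \<not> m \<subseteq> T)"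
  using assms
proof (induction P arbitrary: M rule: finite_induct)
  case empty
  then have "{} \<notin> M"
    by force
  then show ?case
    by auto
next
  case (insert X P)
  obtain a b where ab: "a \<in> X" "b \<in> X" "a \<noteq> b"
    using bspec[OF insert.prems(2) insertI1] card_le_Suc0_iff_eq[of X]
    by (metis card.infinite insertI1 not_less_eq_eq numeral_2_eq_2 zero_le)
  have disjP: "disjoint P"
    using insert.prems(1) by (simp add: pairwise_insert)
  have off: "X \<inter> \<Union>P = {}"
    using insert.prems(1) insert.hyps(2) by (fastforce simp: pairwise_insert disjnt_def)
  have extend: "\<exists>T\<subseteq>\<Union>(insert X P). (\<forall>X\<in>insert X P. \<exists>x. T \<inter> X = {x}) \<and> (\<forall>m\<in>M. \<not> m \<subseteq> T)"
    if T: "T \<subseteq> \<Union>P" "\<forall>Y\<in>P. \<exists>x. T \<inter> Y = {x}" and c: "c \<in> X" "\<forall>m\<in>M. \<not> m \<subseteq> insert c T" for T c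
  proof (intro exI[of _ "insert c T"] conjI ballI)
    show "insert c T \<subseteq> \<Union>(insert X P)"
      using T(1) c(1) by blast
    fix Y assume "Y \<in> insert X P"
    then consider "Y = X" | "Y \<in> P" "c \<notin> Y"
      using off c(1) by blast
    then show "\<exists>x. insert c T \<inter> Y = {x}"
    proof cases
      case 1
      then have "insert c T \<inter> Y = {c}"
        using T(1) off c(1) by blast
      then show ?thesis ..
    next
      case 2
      then have "insert c T \<inter> Y = T \<inter> Y"
        by blast
      then show ?thesis
        using T(2) 2 by auto
    qed
  qed (use c(2) in blast)
  have IH: "\<exists>T\<subseteq>\<Union>P. (\<forall>X\<in>P. \<exists>x. T \<inter> X = {x}) \<and> (\<forall>m\<in>M'. \<not> m \<subseteq> T)"
    if "disjoint M'" "\<forall>m\<in>M'. 2 \<le> card m" for M'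
    using insert.IH[OF disjP _ that] insert.prems(2) by simp
  have uniq: "m = m'" if "m \<in> M" "m' \<in> M" "x \<in> m" "x \<in> m'" for m m' x
    using insert.prems(3) that unfolding disjoint_def by blast
  show ?case
  proof (cases "\<exists>ma mb. ma \<in> M \<and> mb \<in> M \<and> ma \<noteq> mb \<and> a \<in> ma \<and> b \<in> mb")
    case True
    then obtain ma mb where m: "ma \<in> M" "mb \<in> M" "ma \<noteq> mb" "a \<in> ma" "b \<in> mb"
      by blast
    let ?n = "(ma - {a}) \<union> (mb - {b})"
    let ?M' = "insert ?n (M - {ma, mb})"
    have "disjoint ?M'"
      using insert.prems(3) m unfolding disjoint_def by blast
    moreover have "2 \<le> card ?n"
    proof -
      have fin: "finite ma" "finite mb"
        using bspec[OF insert.prems(4) m(1)] bspec[OF insert.prems(4) m(2)] card.infinite[of ma] card.infinite[of mb]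
        by fastforce+
      have "(ma - {a}) \<inter> (mb - {b}) = {}"
        using uniq m by blast
      then have "card ?n = (card ma - 1) + (card mb - 1)"
        using fin m by (simp add: card_Un_disjoint)
      then show ?thesis
        using bspec[OF insert.prems(4) m(1)] bspec[OF insert.prems(4) m(2)] by simp
    qed
    ultimately have "\<exists>T\<subseteq>\<Union>P. (\<forall>X\<in>P. \<exists>x. T \<inter> X = {x}) \<and> (\<forall>m\<in>?M'. \<not> m \<subseteq> T)"
      by (intro IH) (use insert.prems(4) in auto)
    then obtain T where T: "T \<subseteq> \<Union>P" "\<forall>Y\<in>P. \<exists>x. T \<inter> Y = {x}" "\<forall>m\<in>?M'. \<not> m \<subseteq> T"
      by blast
    have abT: "a \<notin> T" "b \<notin> T"
      using T(1) off ab by auto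
    have ok: "\<not> m' \<subseteq> insert c T"
      if c: "c = a \<and> \<not> ma - {a} \<subseteq> T \<or> c = b \<and> \<not> mb - {b} \<subseteq> T" and m': "m' \<in> M" for c m'
    proof (cases "m' \<in> {ma, mb}")
      case True
      then show ?thesis
        using c m ab abT by blast
    next
      case False
      have "c \<in> ma \<or> c \<in> mb"
        using c m(4,5) by blast
      then have "c \<notin> m'"
        using False uniq[OF m' m(1)] uniq[OF m' m(2)] by blast
      moreover have "\<not> m' \<subseteq> T"
        using T(3) m' False by blast
      ultimately show ?thesis
        by blast
    qed
    have "\<not> ma - {a} \<subseteq> T \<or> \<not> mb - {b} \<subseteq> T"
      using T(3) by auto
    then show ?thesis
    proof
      assume "\<not> ma - {a} \<subseteq> T"
      then show ?thesis
        by (intro extend[OF T(1,2) ab(1)] ballI ok) simp_all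
    next
      assume "\<not> mb - {b} \<subseteq> T"
      then show ?thesis
        by (intro extend[OF T(1,2) ab(2)] ballI ok) simp_all
    qed
  next
    case False
    obtain T where T: "T \<subseteq> \<Union>P" "\<forall>Y\<in>P. \<exists>x. T \<inter> Y = {x}" "\<forall>m\<in>M. \<not> m \<subseteq> T"
      using IH[OF insert.prems(3,4)] by (elim exE conjE) (rule that)
    have abT: "a \<notin> T" "b \<notin> T"
      using T(1) off ab by auto
    have pick: ?thesis if c: "{c, c'} = {a, b}" "\<And>m. m \<in> M \<Longrightarrow> c \<in> m \<Longrightarrow> c' \<in> m" for c c'
    proof (rule extend[OF T(1,2), of c])
      show "c \<in> X"
        using c(1) ab by auto
      have "c' \<notin> insert c T"
        using c(1) ab(3) abT by (auto simp: doubleton_eq_iff)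
      then show "\<forall>m\<in>M. \<not> m \<subseteq> insert c T"
        using c(2) T(3) by blast
    qed
    show ?thesis
    proof (cases "\<exists>m\<in>M. b \<in> m")
      case True
      then have "\<And>m. m \<in> M \<Longrightarrow> a \<in> m \<Longrightarrow> b \<in> m"
        using False by blast
      then show ?thesis
        by (intro pick[of a b]) auto
    next
      case no_b: False
      then show ?thesis
        by (intro pick[of b a]) auto
    qed
  qed
qed

text \<open>
  Let \<open>M\<close> be a maximal matching in \<open>R\<close>. Splitting each class into two halves and avoiding the edges of \<open>M\<close>
  leaves at least two candidates in each class. A vertex with two neighbours among the candidates is now
  unmatched, and by maximality of \<open>M\<close> the closed neighbourhoods of such vertices are pairwise disjoint. So
  the avoidance lemma applies a second time, with these neighbourhoods as forbidden sets.
\<close>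
lemma transversal_degree_one:
  fixes R :: "'v \<Rightarrow> 'v \<Rightarrow> bool"
  assumes fin: "finite P" and disj: "disjoint P" and big: "\<And>X. X \<in> P \<Longrightarrow> 4 \<le> card X"
    and sym: "\<And>x y. R x y \<Longrightarrow> R y x" and irrefl: "\<And>x. \<not> R x x"
    and deg: "\<And>x. x \<in> \<Union>P \<Longrightarrow> card {y \<in> \<Union>P. R x y} \<le> 2"
  shows "\<exists>T\<subseteq>\<Union>P. (\<forall>X\<in>P. \<exists>x. T \<inter> X = {x}) \<and> (\<forall>x\<in>T. card {y \<in> T. R x y} \<le> 1)"
proof -
  define W where "W = \<Union>P"
  define N where "N x = {y \<in> W. R x y}" for x
  have finX: "finite X" if "X \<in> P" for X
    using big[OF that] card.infinite[of X] by fastforce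
  have finW: "finite W"
    unfolding W_def using fin finX by blast
  have finN: "finite (N x)" for x
    unfolding N_def using finW by simp
  have deg2: "card (N x) \<le> 2" if "x \<in> W" for x
    using deg that unfolding N_def W_def .
  define E where "E = {{x, y} | x y. x \<in> W \<and> y \<in> N x}"
  have "E \<subseteq> Pow W"
    unfolding E_def N_def by auto
  then have "finite E"
    using finW finite_subset by blast
  then have "finite {M. M \<subseteq> E \<and> disjoint M}"
    by simp
  moreover have "{M. M \<subseteq> E \<and> disjoint M} \<noteq> {}"
  proof -
    have "{} \<in> {M. M \<subseteq> E \<and> disjoint M}"
      by simp
    then show ?thesis
      by blast
  qed
  ultimately have "\<exists>M\<in>{M. M \<subseteq> E \<and> disjoint M}. \<forall>M'\<in>{M. M \<subseteq> E \<and> disjoint M}. M \<subseteq> M' \<longrightarrow> M = M'"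
    by (rule finite_has_maximal)
  then obtain M where M: "M \<subseteq> E" "disjoint M"
    and max: "\<And>M'. M' \<subseteq> E \<Longrightarrow> disjoint M' \<Longrightarrow> M \<subseteq> M' \<Longrightarrow> M = M'"
    by (metis (mono_tags, lifting) mem_Collect_eq)
  have meets: "e \<inter> \<Union>M \<noteq> {}" if e: "e \<in> E" for e
  proof
    assume *: "e \<inter> \<Union>M = {}"
    have "e \<noteq> {}"
      using e unfolding E_def by auto
    then have "e \<notin> M"
      using * by blast
    moreover have "disjoint (insert e M)"
      using M(2) * unfolding disjoint_def by blast
    ultimately show False
      using max[of "insert e M"] M(1) e by blast
  qed
  have M_edge: "\<exists>y. m = {x, y} \<and> y \<in> N x" if m: "m \<in> M" "x \<in> m" for m x
  proof -
    obtain s t where "m = {s, t}" "s \<in> W" "t \<in> N s"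
      using m(1) M(1) unfolding E_def by blast
    then have "m = {s, t} \<and> t \<in> N s" "m = {t, s} \<and> s \<in> N t"
      using sym unfolding N_def by auto
    then show ?thesis
      using m(2) by blast
  qed
  have edgeE: "{x, y} \<in> E" if "x \<in> W" "y \<in> N x" for x y
    unfolding E_def using that by blast
  have M_card: "\<forall>m\<in>M. 2 \<le> card m"
  proof
    fix m assume m: "m \<in> M"
    obtain x y where "m = {x, y}" "y \<in> N x"
      using m M(1) unfolding E_def by blast
    moreover have "x \<noteq> y"
      using calculation(2) irrefl[of x] unfolding N_def by blast
    ultimately show "2 \<le> card m"
      by simp
  qed
  have "\<exists>F G. F \<subseteq> X \<and> G \<subseteq> X \<and> F \<inter> G = {} \<and> card F = 2 \<and> card G = 2" if X: "X \<in> P" for X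
  proof -
    have "2 \<le> card X"
      using big[OF X] by simp
    then obtain F where F: "F \<subseteq> X" "card F = 2" "finite F"
      by (rule obtain_subset_with_card_n)
    then have "2 \<le> card (X - F)"
      using big[OF X] by (simp add: card_Diff_subset)
    then obtain G where "G \<subseteq> X - F" "card G = 2"
      by (rule obtain_subset_with_card_n)
    then show ?thesis
      using F by blast
  qed
  then obtain f g where fg: "\<And>X. X \<in> P \<Longrightarrow> f X \<subseteq> X \<and> g X \<subseteq> X \<and> f X \<inter> g X = {} \<and>
      card (f X) = 2 \<and> card (g X) = 2"
    by metis
  have halves: "disjoint (f ` P \<union> g ` P)"
    unfolding disjoint_def
  proof (intro ballI impI)
    fix Y Z assume "Y \<in> f ` P \<union> g ` P" "Z \<in> f ` P \<union> g ` P" "Y \<noteq> Z"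
    then obtain X X' where X: "X \<in> P" "X' \<in> P" "Y \<in> {f X, g X}" "Z \<in> {f X', g X'}"
      by blast
    show "Y \<inter> Z = {}"
    proof (cases "X = X'")
      case True
      then show ?thesis
        using X fg[of X] \<open>Y \<noteq> Z\<close> by auto
    next
      case False
      then have "X \<inter> X' = {}"
        using disj X unfolding disjoint_def by blast
      then show ?thesis
        using X(3,4) fg[OF X(1)] fg[OF X(2)] by blast
    qed
  qed
  have halves_card: "\<forall>Y\<in>f ` P \<union> g ` P. 2 \<le> card Y"
    using fg by force
  have halves_fin: "finite (f ` P \<union> g ` P)"
    using fin by simp
  obtain T1 where T1: "T1 \<subseteq> \<Union>(f ` P \<union> g ` P)"
      "\<forall>Y\<in>f ` P \<union> g ` P. \<exists>x. T1 \<inter> Y = {x}" "\<forall>m\<in>M. \<not> m \<subseteq> T1"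
    using transversal_avoiding[OF halves_fin halves halves_card M(2) M_card] by (elim exE conjE) (rule that)
  have two: "2 \<le> card (T1 \<inter> X)" if X: "X \<in> P" for X
  proof -
    obtain x where x: "T1 \<inter> f X = {x}"
      using bspec[OF T1(2) UnI1[OF imageI[OF X]]] ..
    obtain y where y: "T1 \<inter> g X = {y}"
      using bspec[OF T1(2) UnI2[OF imageI[OF X]]] ..
    have "x \<in> T1 \<inter> f X" "y \<in> T1 \<inter> g X"
      unfolding x y by auto
    then have "{x, y} \<subseteq> T1 \<inter> X" "x \<noteq> y"
      using fg[OF X] by blast+
    then show ?thesis
      using card_mono[of "T1 \<inter> X" "{x, y}"] finX[OF X] by simp
  qed
  define M2 where "M2 = {insert v (N v) | v. v \<in> W - \<Union>M \<and> card (N v) = 2}"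
  have unmatched: "insert v (N v) \<inter> insert v' (N v') = {}"
    if v: "v \<in> W - \<Union>M" "v' \<in> W - \<Union>M" "v \<noteq> v'" for v v'
  proof (rule ccontr)
    assume "insert v (N v) \<inter> insert v' (N v') \<noteq> {}"
    then obtain z where z: "z \<in> insert v (N v)" "z \<in> insert v' (N v')"
      by blast
    \<comment> \<open>An edge between unmatched vertices could be added to \<open>M\<close>.\<close>
    have nonadj: "v \<notin> N v'" "v' \<notin> N v"
      using meets[OF edgeE, of v' v] meets[OF edgeE, of v v'] v by auto
    then have zN: "z \<in> N v" "z \<in> N v'"
      using z v(3) by auto
    then have zW: "z \<in> W" and vz: "{v, v'} \<subseteq> N z"
      using v sym unfolding N_def by auto
    \<comment> \<open>As \<open>M\<close> is maximal, \<open>z\<close> is matched; but its only possible partners \<open>v\<close> and \<open>v'\<close> are unmatched.\<close>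
    have "N z = {v, v'}"
      using card_seteq[OF finN vz] deg2[OF zW] v(3) by simp
    moreover have "z \<in> \<Union>M"
      using meets[OF edgeE, of v z] v zN by auto
    then obtain y where "y \<in> N z" "y \<in> \<Union>M"
      using M_edge by blast
    ultimately show False
      using v by auto
  qed
  have M2: "disjoint M2"
    unfolding disjoint_def
  proof (intro ballI impI)
    fix m m' assume "m \<in> M2" "m' \<in> M2" "m \<noteq> m'"
    moreover obtain v where "m = insert v (N v)" "v \<in> W - \<Union>M"
      using \<open>m \<in> M2\<close> unfolding M2_def by auto
    moreover obtain v' where "m' = insert v' (N v')" "v' \<in> W - \<Union>M"
      using \<open>m' \<in> M2\<close> unfolding M2_def by auto
    ultimately show "m \<inter> m' = {}"
      using unmatched[of v v'] by metis
  qed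
  have M2_card: "\<forall>m\<in>M2. 2 \<le> card m"
  proof
    fix m assume m: "m \<in> M2"
    obtain v where "m = insert v (N v)" "card (N v) = 2"
      using m unfolding M2_def by blast
    then show "2 \<le> card m"
      using card_insert_le[of "N v" v] by simp
  qed
  have rest: "disjoint ((\<lambda>X. T1 \<inter> X) ` P)"
    using disj unfolding disjoint_def by blast
  have rest_fin: "finite ((\<lambda>X. T1 \<inter> X) ` P)"
    using fin by simp
  have rest_card: "\<forall>Y\<in>(\<lambda>X. T1 \<inter> X) ` P. 2 \<le> card Y"
    using two by blast
  obtain T where T: "T \<subseteq> \<Union>((\<lambda>X. T1 \<inter> X) ` P)"
      "\<forall>Y\<in>(\<lambda>X. T1 \<inter> X) ` P. \<exists>x. T \<inter> Y = {x}" "\<forall>m\<in>M2. \<not> m \<subseteq> T"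
    using transversal_avoiding[OF rest_fin rest rest_card M2 M2_card] by (elim exE conjE) (rule that)
  have TT: "T \<subseteq> T1" "T \<subseteq> W"
    using T(1) unfolding W_def by auto
  show ?thesis
  proof (intro exI[of _ T] conjI ballI)
    show "T \<subseteq> \<Union>P"
      using TT(2) unfolding W_def .
  next
    fix X assume "X \<in> P"
    then obtain x where "T \<inter> (T1 \<inter> X) = {x}"
      using T(2) by blast
    then have "T \<inter> X = {x}"
      using TT(1) by blast
    then show "\<exists>x. T \<inter> X = {x}" ..
  next
    fix x assume x: "x \<in> T"
    show "card {y \<in> T. R x y} \<le> 1"
    proof (rule ccontr)
      assume many: "\<not> ?thesis"
      have sub: "{y \<in> T. R x y} \<subseteq> N x"
        using TT(2) unfolding N_def by blast
      have xW: "x \<in> W"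
        using x TT(2) by blast
      have eq: "{y \<in> T. R x y} = N x"
        using card_seteq[OF finN sub] many deg2[OF xW] by simp
      have "x \<notin> \<Union>M"
      proof
        assume "x \<in> \<Union>M"
        then obtain m y where "m \<in> M" "m = {x, y}" "y \<in> N x"
          using M_edge by blast
        moreover have "y \<in> T"
          using \<open>y \<in> N x\<close> unfolding eq[symmetric] by simp
        ultimately have "m \<subseteq> T1"
          using TT(1) x by auto
        then show False
          using T1(3) \<open>m \<in> M\<close> by blast
      qed
      moreover have "card (N x) = 2"
        using many deg2[OF xW] unfolding eq by simp
      ultimately have "insert x (N x) \<in> M2"
        using xW unfolding M2_def by blast
      moreover have "insert x (N x) \<subseteq> T"
        using x unfolding eq[symmetric] by blast
      ultimately show False
        using T(3) by blast
    qed
  qed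
qed

section \<open>Hitting very large cliques\<close>

context degree_split
begin

definition p_cliques :: "'v set set" where
  "p_cliques = {A. A \<subseteq> V \<and> clique A \<and> card A = p}"

lemma p_cliqueD:
  assumes "A \<in> p_cliques"
  shows "A \<subseteq> V" "clique A" "card A = p" "finite A" "A \<noteq> {}"
  using assms finite_subset[OF _ finite_V, of A] two_le_p unfolding p_cliques_def by auto

lemma union_meeting_cliques:
  assumes "A \<in> p_cliques" "B \<in> p_cliques" "A \<inter> B \<noteq> {}" and q: "q = 2"
  shows "card (A \<union> B) \<le> p + 2"
proof -
  note A = p_cliqueD[OF assms(1)] and B = p_cliqueD[OF assms(2)]
  obtain m where m: "m \<in> A" "m \<in> B"
    using assms(3) by blast
  have "A \<union> B \<subseteq> insert m (nbrs m)"
    using cliqueD[OF A(2) m(1)] cliqueD[OF B(2) m(2)] by blast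
  then have "card (A \<union> B) \<le> card (insert m (nbrs m))"
    by (intro card_mono) auto
  also have "\<dots> \<le> p + 2"
    using degree[of m] q by simp
  finally show ?thesis .
qed

text \<open>
  The closed neighbourhood of a common vertex contains both cliques and has at most \<open>p + 2\<close> vertices, so
  at least \<open>p - 2\<close> are shared. If \<open>p - 1\<close> were shared, the union would be a forbidden near-clique on
  \<open>p + 1\<close> vertices.
\<close>
lemma card_meeting_cliques:
  assumes "A \<in> p_cliques" "B \<in> p_cliques" "A \<inter> B \<noteq> {}" "A \<noteq> B" and q: "q = 2"
  shows "card (A \<inter> B) = p - 2"
proof -
  note A = p_cliqueD[OF assms(1)] and B = p_cliqueD[OF assms(2)]
  have sum: "card (A \<union> B) + card (A \<inter> B) = 2 * p"
    using card_Un_Int[OF A(4) B(4)] A(3) B(3) by simp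
  have lower: "p - 2 \<le> card (A \<inter> B)"
    using sum union_meeting_cliques[OF assms(1-3) q] by simp
  have "card (A \<inter> B) \<noteq> p"
    using card_subset_eq[of A "A \<inter> B"] card_subset_eq[of B "A \<inter> B"] A B assms(4) by auto
  moreover have "card (A \<inter> B) \<le> p"
    using card_mono[OF A(4), of "A \<inter> B"] A(3) by simp
  moreover have "card (A \<inter> B) \<noteq> p - 1"
  proof
    assume c: "card (A \<inter> B) = p - 1"
    have "card (A - B) = 1" "card (B - A) = 1"
      using c A B card_Diff_subset_Int[of A B] card_Diff_subset_Int[of B A] two_le_p
      by (auto simp: Int_commute)
    then obtain a b where ab: "A - B = {a}" "B - A = {b}"
      by (auto simp: card_1_singleton_iff)
    have "adj x y \<or> {x, y} = {a, b}" if xy: "x \<in> A \<union> B" "y \<in> A \<union> B" "x \<noteq> y" for x y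
    proof -
      consider "x \<in> A" "y \<in> A" | "x \<in> B" "y \<in> B" | "x \<in> A - B" "y \<in> B - A" | "x \<in> B - A" "y \<in> A - B"
        using xy by blast
      then show ?thesis
      proof cases
        case 3
        then show ?thesis
          unfolding ab by simp
      next
        case 4
        then show ?thesis
          unfolding ab by auto
      qed (use A(2) B(2) xy(3) in \<open>auto simp: clique_def\<close>)
    qed
    then have "near_clique (A \<union> B)"
      unfolding near_clique_def by blast
    moreover have "card (A \<union> B) = p + 1"
      using sum c two_le_p by simp
    ultimately show False
      using no_large_clique[of "A \<union> B"] A(1) B(1) q by simp
  qed
  ultimately show ?thesis
    using lower by linarith
qed

text \<open>
  Both \<open>A\<close> and \<open>C\<close> contain all but at most two of the \<open>p\<close> vertices of \<open>B\<close>.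
\<close>
lemma meeting_cliques_overlap:
  assumes "A \<in> p_cliques" "B \<in> p_cliques" "C \<in> p_cliques" "B \<inter> A \<noteq> {}" "B \<inter> C \<noteq> {}"
    and q: "q = 2" and p: "6 \<le> p"
  shows "A \<inter> C \<noteq> {}" and "A \<inter> B \<inter> C \<noteq> {}"
proof -
  note B = p_cliqueD[OF assms(2)]
  have "p - 2 \<le> card (B \<inter> A)" "p - 2 \<le> card (B \<inter> C)"
    using card_meeting_cliques[OF assms(2,1,4) _ q] card_meeting_cliques[OF assms(2,3,5) _ q] B(3)
    by (cases "B = A"; cases "B = C"; simp)+
  moreover have "card (B \<inter> A) + card (B \<inter> C) \<le> p" if "B \<inter> A \<inter> (B \<inter> C) = {}"
    using card_Un_disjoint[OF _ _ that] card_mono[OF B(4), of "B \<inter> A \<union> B \<inter> C"] B(3,4) by simp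
  ultimately have "B \<inter> A \<inter> (B \<inter> C) \<noteq> {}"
    using p by fastforce
  then show "A \<inter> C \<noteq> {}" and "A \<inter> B \<inter> C \<noteq> {}"
    by blast+
qed

text \<open>
  Three such cliques would share a vertex, whose closed neighbourhood is already \<open>A \<union> B\<close>. Hence \<open>C\<close> lies
  in \<open>A \<union> B\<close>, and by counting it contains both \<open>A - B\<close> and \<open>B - A\<close>. This makes \<open>A \<union> B\<close> a clique on \<open>p + 2\<close>
  vertices.
\<close>
lemma no_three_meeting_cliques:
  assumes ABC: "A \<in> p_cliques" "B \<in> p_cliques" "C \<in> p_cliques"
    and ne: "A \<noteq> B" "A \<noteq> C" "B \<noteq> C" and meet: "A \<inter> B \<noteq> {}" "A \<inter> C \<noteq> {}"
    and q: "q = 2" and p: "6 \<le> p"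
  shows False
proof -
  note A = p_cliqueD[OF ABC(1)] and B = p_cliqueD[OF ABC(2)] and C = p_cliqueD[OF ABC(3)]
  have BC: "B \<inter> C \<noteq> {}" and all: "B \<inter> A \<inter> C \<noteq> {}"
    using meeting_cliques_overlap[OF ABC(2,1,3) _ meet(2) q p] meet(1) by (auto simp: Int_commute)
  have AB: "card (A \<inter> B) = p - 2" and AC: "card (A \<inter> C) = p - 2" and BC': "card (B \<inter> C) = p - 2"
    using card_meeting_cliques ABC ne meet BC q by blast+
  have cAB: "card (A \<union> B) = p + 2"
    using card_Un_Int[OF A(4) B(4)] A(3) B(3) AB p by simp
  obtain m where m: "m \<in> A" "m \<in> B" "m \<in> C"
    using all by blast
  have sub: "A \<union> B \<union> C \<subseteq> insert m (nbrs m)"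
    using cliqueD[OF A(2) m(1)] cliqueD[OF B(2) m(2)] cliqueD[OF C(2) m(3)] by blast
  have "card (insert m (nbrs m)) \<le> p + 2"
    using degree[of m] q by simp
  then have "A \<union> B = insert m (nbrs m)"
    using card_seteq[of "insert m (nbrs m)" "A \<union> B"] sub cAB by simp
  then have C_sub: "C = A \<inter> C \<union> B \<inter> C"
    using sub by blast
  have "card C + card (A \<inter> C \<inter> (B \<inter> C)) = card (A \<inter> C) + card (B \<inter> C)"
    using card_Un_Int[of "A \<inter> C" "B \<inter> C"] C_sub A(4) B(4) by simp
  then have tri: "card (A \<inter> C \<inter> (B \<inter> C)) = p - 4"
    using C(3) AC BC' p by simp
  have "A - B \<subseteq> C"
  proof -
    have "A \<inter> C - B = A \<inter> C - A \<inter> C \<inter> (B \<inter> C)"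
      by blast
    then have "card (A \<inter> C - B) = 2"
      using card_Diff_subset[of "A \<inter> C \<inter> (B \<inter> C)" "A \<inter> C"] tri AC p A(4) by fastforce
    moreover have "card (A - B) = 2"
      using AB A(3,4) p card_Diff_subset_Int[of A B] by simp
    ultimately have "A \<inter> C - B = A - B"
      using A(4) by (intro card_subset_eq) auto
    then show ?thesis
      by blast
  qed
  moreover have "B - A \<subseteq> C"
  proof -
    have "B \<inter> C - A = B \<inter> C - A \<inter> C \<inter> (B \<inter> C)"
      by blast
    then have "card (B \<inter> C - A) = 2"
      using card_Diff_subset[of "A \<inter> C \<inter> (B \<inter> C)" "B \<inter> C"] tri BC' p B(4) by fastforce
    moreover have "card (B - A) = 2"
      using AB B(3,4) p card_Diff_subset_Int[of B A] by (simp add: Int_commute)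
    ultimately have "B \<inter> C - A = B - A"
      using B(4) by (intro card_subset_eq) auto
    then show ?thesis
      by blast
  qed
  ultimately have "clique (A \<union> B)"
    using A(2) B(2) C(2) unfolding clique_def by blast
  then show False
    using no_large_clique[of "A \<union> B"] clique_near_clique cAB A(1) B(1) q by auto
qed

text \<open>
  The part of \<open>A\<close> shared by all \<open>p\<close>-cliques that meet \<open>A\<close>: one vertex of it hits the whole cluster.
\<close>
definition common_part :: "'v set \<Rightarrow> 'v set" where
  "common_part A = \<Inter>{B \<in> p_cliques. B \<inter> A \<noteq> {}}"

lemma common_part_subset: "A \<in> p_cliques \<Longrightarrow> common_part A \<subseteq> A"
  using p_cliqueD(5)[of A] unfolding common_part_def by blast

lemma common_part_eq:
  assumes "A \<in> p_cliques" "B \<in> p_cliques" "A \<inter> B \<noteq> {}" and "q = 2" "6 \<le> p"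
  shows "common_part A = common_part B"
proof -
  have "C \<inter> A \<noteq> {} \<longleftrightarrow> C \<inter> B \<noteq> {}" if "C \<in> p_cliques" for C
    using meeting_cliques_overlap(1)[OF assms(1,2) that] meeting_cliques_overlap(1)[OF assms(2,1) that]
      assms(3-5) by (auto simp: Int_commute)
  then show ?thesis
    unfolding common_part_def by (intro arg_cong[of _ _ Inter]) blast
qed

text \<open>
  The cluster of \<open>A\<close> consists of \<open>A\<close> and at most one other clique, which shares \<open>p - 2\<close> vertices with it.
\<close>
lemma card_common_part:
  assumes A: "A \<in> p_cliques" and q: "q = 2" and p: "6 \<le> p"
  shows "4 \<le> card (common_part A)"
proof (cases "\<exists>B\<in>p_cliques. B \<noteq> A \<and> B \<inter> A \<noteq> {}")
  case True
  then obtain B where B: "B \<in> p_cliques" "B \<noteq> A" "B \<inter> A \<noteq> {}"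
    by blast
  have "C = A \<or> C = B" if "C \<in> p_cliques" "C \<inter> A \<noteq> {}" for C
    using no_three_meeting_cliques[OF A B(1) that(1)] B that q p by (auto simp: Int_commute)
  then have "{C \<in> p_cliques. C \<inter> A \<noteq> {}} = {A, B}"
    using A B p_cliqueD(5)[OF A] by auto
  then have "common_part A = A \<inter> B"
    unfolding common_part_def by simp
  then show ?thesis
    using card_meeting_cliques[OF A B(1) _ _ q] B p by (simp add: Int_commute)
next
  case False
  then have "{C \<in> p_cliques. C \<inter> A \<noteq> {}} = {A}"
    using A p_cliqueD(5)[OF A] by auto
  then show ?thesis
    using p_cliqueD(3)[OF A] p unfolding common_part_def by simp
qed

text \<open>
  Choose one vertex from each common part. Edges within a \<open>p\<close>-clique do not matter for this choice, as
  at most one vertex of the clique is chosen; and a vertex has at most two neighbours outside its clique.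
\<close>
theorem hitting_degree_one:
  assumes q: "q = 2" and p: "6 \<le> p"
  shows "\<exists>S. hitting S \<and> (\<forall>x\<in>S. card (nbrs x \<inter> S) \<le> 1)"
proof -
  let ?P = "common_part ` p_cliques"
  define R where "R x y \<longleftrightarrow> adj x y \<and> \<not> (\<exists>A\<in>p_cliques. x \<in> A \<and> y \<in> A)" for x y
  have same: "x \<in> common_part A" if x: "x \<in> \<Union>?P" "x \<in> A" and A: "A \<in> p_cliques" for x A
  proof -
    obtain B where B: "B \<in> p_cliques" "x \<in> common_part B"
      using x(1) by blast
    then have "A \<inter> B \<noteq> {}"
      using common_part_subset x(2) by blast
    then show ?thesis
      using common_part_eq[OF A B(1) _ q p] B(2) by simp
  qed
  have "finite p_cliques"
    unfolding p_cliques_def using finite_V by simp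
  then have 1: "finite ?P"
    by simp
  have 2: "disjoint ?P"
    unfolding disjoint_def
  proof (intro ballI impI)
    fix X Y assume XY: "X \<in> ?P" "Y \<in> ?P" "X \<noteq> Y"
    obtain A B where AB: "A \<in> p_cliques" "X = common_part A" "B \<in> p_cliques" "Y = common_part B"
      using XY(1,2) by blast
    then have "A \<inter> B = {}"
      using common_part_eq[OF AB(1,3) _ q p] XY(3) by blast
    then show "X \<inter> Y = {}"
      using common_part_subset AB by blast
  qed
  have 3: "4 \<le> card X" if "X \<in> ?P" for X
    using that card_common_part[OF _ q p] by blast
  have 4: "R y x" if "R x y" for x y
    using that adj_sym unfolding R_def by blast
  have 5: "\<not> R x x" for x
    using adj_irrefl unfolding R_def by blast
  have 6: "card {y \<in> \<Union>?P. R x y} \<le> 2" if x: "x \<in> \<Union>?P" for x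
  proof -
    obtain A where A: "A \<in> p_cliques" "x \<in> A"
      using x common_part_subset by blast
    note A' = p_cliqueD[OF A(1)]
    have sub: "A - {x} \<subseteq> nbrs x"
      using cliqueD[OF A'(2) A(2)] by blast
    have "{y \<in> \<Union>?P. R x y} \<subseteq> nbrs x - (A - {x})"
      using A unfolding R_def nbrs_def by blast
    then have "card {y \<in> \<Union>?P. R x y} \<le> card (nbrs x - (A - {x}))"
      by (intro card_mono) auto
    also have "\<dots> = card (nbrs x) - (p - 1)"
      using sub A A' by (simp add: card_Diff_subset)
    also have "\<dots> \<le> 2"
      using degree[of x] q by simp
    finally show ?thesis .
  qed
  have "\<exists>T\<subseteq>\<Union>?P. (\<forall>X\<in>?P. \<exists>x. T \<inter> X = {x}) \<and> (\<forall>x\<in>T. card {y \<in> T. R x y} \<le> 1)"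
    by (rule transversal_degree_one[OF 1 2 3 4 5 6])
  then obtain T where T: "T \<subseteq> \<Union>?P" "\<forall>X\<in>?P. \<exists>x. T \<inter> X = {x}" "\<forall>x\<in>T. card {y \<in> T. R x y} \<le> 1"
    by (elim exE conjE) (rule that)
  have hit: "A \<inter> T \<noteq> {}" if "A \<in> p_cliques" for A
    using T(2) that common_part_subset[OF that] by blast
  have "T \<subseteq> V"
    using T(1) common_part_subset p_cliqueD(1) by blast
  then have "hitting T"
    using hit unfolding hitting_def p_cliques_def by blast
  moreover have "nbrs x \<inter> T = {y \<in> T. R x y}" if x: "x \<in> T" for x
  proof -
    have "R x y" if y: "y \<in> T" "adj x y" for y
      unfolding R_def
    proof (intro conjI notI)
      assume "\<exists>A\<in>p_cliques. x \<in> A \<and> y \<in> A"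
      then obtain A where A: "A \<in> p_cliques" "x \<in> A" "y \<in> A"
        by blast
      then have "x \<in> common_part A" "y \<in> common_part A"
        using same x y(1) T(1) by blast+
      moreover obtain z where "T \<inter> common_part A = {z}"
        using T(2) A(1) by blast
      ultimately have "x = y"
        using x y(1) by (metis IntI singletonD)
      then show False
        using y(2) adj_irrefl by blast
    qed (rule y(2))
    then show ?thesis
      unfolding nbrs_def R_def by blast
  qed
  ultimately show ?thesis
    using T(3) by auto
qed

section \<open>The partition\<close>

text \<open>
  If two \<open>q\<close>-cliques in \<open>S\<close> share a vertex \<open>x\<close>, then without \<open>x\<close> they are two different
  \<open>(q - 1)\<close>-cliques among the at most \<open>q\<close> neighbours of \<open>x\<close> in \<open>S\<close>. They cover these neighbours and all
  pairs of them but one, so \<open>x\<close> is a core vertex. For \<open>q = 2\<close> a vertex has at most one neighbour in the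
  hitting set, so it cannot be a core vertex either.
\<close>
theorem hitting_with_disjoint_cliques:
  assumes large: "p + q \<ge> 8"
  shows "\<exists>S. hitting S \<and> cliques_disjoint q S"
proof -
  define sparse where "sparse S x \<longleftrightarrow> card (nbrs x \<inter> S) < q \<or>
    card (nbrs x \<inter> S) = q \<and> \<not> near_clique (nbrs x \<inter> S)" for S x
  have "\<exists>S. hitting S \<and> (\<forall>x\<in>S. sparse S x)"
  proof (cases "q = 2")
    case True
    then have "\<exists>S. hitting S \<and> (\<forall>x\<in>S. card (nbrs x \<inter> S) \<le> 1)"
      using hitting_degree_one large by simp
    then show ?thesis
      using True unfolding sparse_def by fastforce
  next
    case False
    then have q: "3 \<le> q"
      using two_le_q by simp
    obtain S where S: "optimal S"
      using optimal_exists by blast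
    have "sparse S x" if x: "x \<in> S" for x
      using degree_within_smallest(1)[OF optimal_smallest[OF S] x] optimal_no_core[OF S large q, of x] x
      unfolding sparse_def core_def by auto
    then show ?thesis
      using smallest_hittingD[OF optimal_smallest[OF S]] by blast
  qed
  then obtain S where S: "hitting S" and sparse: "\<And>x. x \<in> S \<Longrightarrow> sparse S x"
    by blast
  have "A = B" if AB: "A \<subseteq> S" "B \<subseteq> S" "clique A" "clique B" "card A = q" "card B = q"
    and x: "x \<in> A" "x \<in> B" for A B x
  proof (rule ccontr)
    assume "A \<noteq> B"
    let ?N = "nbrs x \<inter> S" and ?A = "A - {x}" and ?B = "B - {x}"
    have sub: "?A \<subseteq> ?N" "?B \<subseteq> ?N"
      using AB x cliqueD[of A x] cliqueD[of B x] by auto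
    have cAB: "card ?A + 1 = q" "card ?B + 1 = q"
      using AB x two_le_q by auto
    have "?A \<noteq> ?B"
      using \<open>A \<noteq> B\<close> x by blast
    have "\<not> card ?N < q"
    proof
      assume "card ?N < q"
      then have "?A = ?N" "?B = ?N"
        using card_seteq[OF _ sub(1)] card_seteq[OF _ sub(2)] cAB by simp_all
      then show False
        using \<open>?A \<noteq> ?B\<close> by metis
    qed
    then have N: "card ?N = q" "\<not> near_clique ?N"
      using sparse[of x] x AB(1) unfolding sparse_def by auto
    obtain a where a: "a \<in> ?N" "?A = ?N - {a}"
      using codim1_subset[OF _ sub(1)] cAB N(1) by auto
    obtain b where b: "b \<in> ?N" "?B = ?N - {b}"
      using codim1_subset[OF _ sub(2)] cAB N(1) by auto
    have "a \<noteq> b"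
      using a b \<open>?A \<noteq> ?B\<close> by auto
    have "adj s t \<or> {s, t} = {a, b}" if st: "s \<in> ?N" "t \<in> ?N" "s \<noteq> t" for s t
    proof -
      have "{s, t} = {a, b} \<or> a \<notin> {s, t} \<or> b \<notin> {s, t}"
        using st(3) \<open>a \<noteq> b\<close> by (auto simp: doubleton_eq_iff)
      then have "{s, t} = {a, b} \<or> {s, t} \<subseteq> ?A \<or> {s, t} \<subseteq> ?B"
        unfolding a(2) b(2) using st by blast
      then show ?thesis
        using AB(3,4) st(3) unfolding clique_def by blast
    qed
    then show False
      using N(2) unfolding near_clique_def by blast
  qed
  then have "cliques_disjoint q S"
    unfolding cliques_disjoint_def by (metis disjoint_iff)
  then show ?thesis
    using S by blast
qed

text \<open>
  If one part is empty, any single vertex can be moved to it: as \<open>p\<close> and \<open>q\<close> are at least 2, a single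
  vertex contains no clique that matters, and the other part only loses cliques.
\<close>
theorem partition_into_proper_parts:
  assumes large: "p + q \<ge> 8" and V: "2 \<le> card V"
  shows "\<exists>V1 V2. V1 \<union> V2 = V \<and> V1 \<inter> V2 = {} \<and> V1 \<noteq> {} \<and> V2 \<noteq> {} \<and>
    clique_free p V1 \<and> cliques_disjoint q V2"
proof -
  obtain S where S: "hitting S" "cliques_disjoint q S"
    using hitting_with_disjoint_cliques[OF large] by blast
  have SV: "S \<subseteq> V"
    using hitting_subset[OF S(1)] .
  have free: "clique_free p (V - S)"
    using S(1) unfolding hitting_def clique_free_def by blast
  obtain v where v: "v \<in> V"
    using V by fastforce
  have V': "V - {v} \<noteq> {}"
    using V v card_mono[of "{v}" V] by fastforce
  have small: "card A \<noteq> k" if "A \<subseteq> {v}" "2 \<le> k" for A :: "'v set" and k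
    using that card_mono[of "{v}" A] by auto
  consider "S = V" | "S = {}" | "S \<noteq> V" "S \<noteq> {}"
    by blast
  then show ?thesis
  proof cases
    case 1
    have "clique_free p {v}"
      using small[OF _ two_le_p] unfolding clique_free_def by blast
    moreover have "cliques_disjoint q (V - {v})"
      using S(2) 1 unfolding cliques_disjoint_def by blast
    ultimately show ?thesis
      using v V' by (intro exI[of _ "{v}"] exI[of _ "V - {v}"]) auto
  next
    case 2
    have "clique_free p (V - {v})"
      using free 2 unfolding clique_free_def by blast
    moreover have "cliques_disjoint q {v}"
      using small[OF _ two_le_q] unfolding cliques_disjoint_def by blast
    ultimately show ?thesis
      using v V' by (intro exI[of _ "V - {v}"] exI[of _ "{v}"]) auto
  next
    case 3
    then show ?thesis
      using free S(2) SV by (intro exI[of _ "V - S"] exI[of _ S]) auto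
  qed
qed

end

section \<open>From clique sets to subgraphs\<close>

lemma clique_of_complete_graph_copy:
  assumes sub: "subgraph S G" and iso: "digraph_iso S (with_proj (complete_graph n))"
  shows "card (verts S) = n" and "\<And>x y. x \<in> verts S \<Longrightarrow> y \<in> verts S \<Longrightarrow> x \<noteq> y \<Longrightarrow> x \<rightarrow>\<^bsub>G\<^esub> y"
proof -
  obtain f where f: "pre_digraph.digraph_isomorphism S f" "with_proj (complete_graph n) = app_iso f S"
    using iso unfolding digraph_iso_def by blast
  have inj: "inj_on (iso_verts f) (verts S)"
    and comm: "\<And>a. a \<in> arcs S \<Longrightarrow> iso_verts f (tail S a) = iso_tail f (iso_arcs f a) \<and>
      iso_verts f (head S a) = iso_head f (iso_arcs f a)"
    and wf: "wf_digraph S"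
    using f(1) unfolding pre_digraph.digraph_isomorphism_def by auto
  have V: "iso_verts f ` verts S = {..<n}"
    and A: "iso_arcs f ` arcs S = {(u, v). u < n \<and> v < n \<and> u \<noteq> v}"
    and ends: "iso_tail f = fst" "iso_head f = snd"
    using f(2) unfolding app_iso_def with_proj_def complete_graph_def by auto
  show "card (verts S) = n"
    using card_image[OF inj] V by simp
  fix x y assume xy: "x \<in> verts S" "y \<in> verts S" "x \<noteq> y"
  have "iso_verts f x \<noteq> iso_verts f y"
    using inj xy by (auto dest: inj_onD)
  moreover have "iso_verts f x < n" "iso_verts f y < n"
    using V xy by auto
  ultimately obtain e where e: "e \<in> arcs S" "iso_arcs f e = (iso_verts f x, iso_verts f y)"
    using A by (auto simp: image_iff set_eq_iff) (metis (mono_tags, lifting) A case_prodI imageE mem_Collect_eq)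
  have "tail S e = x" "head S e = y"
    using comm[OF e(1)] e(2) ends xy inj wf_digraph.tail_in_verts[OF wf e(1)]
      wf_digraph.head_in_verts[OF wf e(1)] by (auto dest: inj_onD)
  then show "x \<rightarrow>\<^bsub>G\<^esub> y"
    using sub e(1) unfolding subgraph_def compatible_def arcs_ends_conv by force
qed

text \<open>
  Without parallel arcs, a complete subgraph is determined by its vertices. So disjointness of
  cliques as vertex sets is the same as disjointness of cliques as subgraphs.
\<close>
lemma complete_subgraph_eqI:
  assumes "graph H" and C: "subgraph C H" "complete_digraph n C"
    and D: "subgraph D H" "complete_digraph n D" and eq: "verts C = verts D"
  shows "C = D"
proof -
  interpret graph H by fact
  have arcs: "arcs K = {e \<in> arcs H. tail H e \<in> verts K \<and> head H e \<in> verts K}"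
    if K: "subgraph K H" "complete_digraph n K" for K
  proof (intro equalityI subsetI)
    fix e assume e: "e \<in> arcs K"
    interpret K: wf_digraph K
      using K(1) unfolding subgraph_def by simp
    show "e \<in> {e \<in> arcs H. tail H e \<in> verts K \<and> head H e \<in> verts K}"
      using K(1) e K.tail_in_verts[OF e] K.head_in_verts[OF e] unfolding subgraph_def compatible_def by auto
  next
    fix e assume e: "e \<in> {e \<in> arcs H. tail H e \<in> verts K \<and> head H e \<in> verts K}"
    then have "(tail H e, head H e) \<in> arcs_ends K"
      using K(2) no_loops unfolding complete_digraph_def by auto
    then obtain e' where e': "e' \<in> arcs K" "tail K e' = tail H e" "head K e' = head H e"
      unfolding arcs_ends_conv by force
    then have "e' = e"
      using K(1) e no_multi_arcs[of e' e] unfolding subgraph_def compatible_def arc_to_ends_def by auto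
    then show "e \<in> arcs K"
      using e'(1) by simp
  qed
  have "arcs C = arcs D"
    unfolding arcs[OF C] arcs[OF D] eq ..
  then show ?thesis
    using eq C(1) D(1) unfolding subgraph_def compatible_def by simp
qed

text \<open>
  Only the images of \<open>c\<close> and \<open>d\<close> matter: they are sent to 0 and 1, the ends of the removed edge, and the
  rest of \<open>S\<close> is numbered arbitrarily. All arcs within \<open>S\<close> other than those between \<open>c\<close> and \<open>d\<close> are kept,
  whether or not \<open>c\<close> and \<open>d\<close> are adjacent in \<open>H\<close>.
\<close>
lemma complete_minus_edge_copy:
  assumes "graph H" and S: "S \<subseteq> verts H" "card S = n" and cd: "c \<in> S" "d \<in> S" "c \<noteq> d"
    and adj: "\<And>x y. x \<in> S \<Longrightarrow> y \<in> S \<Longrightarrow> x \<noteq> y \<Longrightarrow> {x, y} \<noteq> {c, d} \<Longrightarrow> x \<rightarrow>\<^bsub>H\<^esub> y"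
  shows "\<exists>K. subgraph K H \<and> digraph_iso K (with_proj (complete_graph_minus_edge n))"
proof -
  interpret graph H by fact
  have fin: "finite S"
    using finite_subset[OF S(1) finite_verts] .
  have n: "card {c, d} \<le> n"
    using card_mono[OF fin, of "{c, d}"] cd S(2) by simp
  then have n2: "2 \<le> n"
    using cd(3) by simp
  have "card (S - {c, d}) = card {2..<n}"
    using S(2) cd fin by (simp add: card_Diff_subset)
  then obtain h0 where h0: "bij_betw h0 (S - {c, d}) {2..<n}"
    using finite_same_card_bij[of "S - {c, d}" "{2..<n}"] fin by auto
  define h where "h x = (if x = c then 0 else if x = d then 1 else h0 x)" for x
  have h_out: "h x = h0 x \<and> 2 \<le> h x \<and> h x < n" if "x \<in> S" "x \<noteq> c" "x \<noteq> d" for x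
    using that bij_betwE[OF h0] unfolding h_def by auto
  have h_cd: "h c = 0" "h d = 1"
    using cd(3) unfolding h_def by auto
  have inj: "inj_on h S"
  proof (rule inj_onI)
    fix x y assume xy: "x \<in> S" "y \<in> S" "h x = h y"
    show "x = y"
    proof (cases "x \<in> {c, d} \<or> y \<in> {c, d}")
      case True
      then show ?thesis
        using xy h_out[of x] h_out[of y] h_cd by force
    next
      case False
      then show ?thesis
        using xy h_out[of x] h_out[of y] bij_betw_imp_inj_on[OF h0] by (auto dest: inj_onD)
    qed
  qed
  have img: "h ` S = {..<n}"
  proof -
    have "h ` S \<subseteq> {..<n}"
      using h_out h_cd n2 by (auto split: if_splits) (metis Suc_1 Suc_le_lessD less_2_cases_iff less_le_trans)
    then show ?thesis
      using card_subset_eq[of "{..<n}" "h ` S"] card_image[OF inj] S(2) by simp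
  qed
  define K where "K = \<lparr>verts = S, arcs = {e \<in> arcs H. tail H e \<in> S \<and> head H e \<in> S \<and>
    {tail H e, head H e} \<noteq> {c, d}}, tail = tail H, head = head H\<rparr>"
  define f where "f = \<lparr>iso_verts = h, iso_arcs = (\<lambda>e. (h (tail H e), h (head H e))),
    iso_head = snd, iso_tail = fst\<rparr>"
  have wfK: "wf_digraph K"
    by unfold_locales (auto simp: K_def)
  have subK: "subgraph K H"
    using wfK S(1) wf_digraph_axioms unfolding subgraph_def compatible_def by (auto simp: K_def)
  have "inj_on (iso_arcs f) (arcs K)"
  proof (rule inj_onI)
    fix e e' assume e: "e \<in> arcs K" "e' \<in> arcs K" "iso_arcs f e = iso_arcs f e'"
    then have "tail H e = tail H e'" "head H e = head H e'"
      using inj unfolding K_def f_def by (auto dest: inj_onD)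
    then show "e = e'"
      using no_multi_arcs[of e e'] e(1,2) unfolding K_def arc_to_ends_def by auto
  qed
  then have isoK: "pre_digraph.digraph_isomorphism K f"
    using wfK inj unfolding pre_digraph.digraph_isomorphism_def by (auto simp: K_def f_def)
  have arcs_img: "iso_arcs f ` arcs K = {(u, v). u < n \<and> v < n \<and> u \<noteq> v} - {(0, 1), (1, 0)}"
  proof (intro equalityI subsetI)
    fix a assume "a \<in> iso_arcs f ` arcs K"
    then obtain e where e: "e \<in> arcs H" "tail H e \<in> S" "head H e \<in> S" "{tail H e, head H e} \<noteq> {c, d}"
        "a = (h (tail H e), h (head H e))"
      unfolding K_def f_def by auto
    have "h (tail H e) \<noteq> h (head H e)"
      using inj e no_loops[OF e(1)] by (auto dest: inj_onD)
    moreover have "h (tail H e) < n" "h (head H e) < n"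
      using img e by auto
    moreover have "x = c" if "x \<in> S" "h x = 0" for x
      using inj_onD[OF inj, of x c] that cd h_cd by simp
    moreover have "x = d" if "x \<in> S" "h x = 1" for x
      using inj_onD[OF inj, of x d] that cd h_cd by simp
    ultimately show "a \<in> {(u, v). u < n \<and> v < n \<and> u \<noteq> v} - {(0, 1), (1, 0)}"
      using e by auto
  next
    fix a :: "nat \<times> nat"
    assume a: "a \<in> {(u, v). u < n \<and> v < n \<and> u \<noteq> v} - {(0, 1), (1, 0)}"
    obtain u v where "a = (u, v)"
      by (cases a)
    then have uv: "a = (u, v)" "u < n" "v < n" "u \<noteq> v" "(u, v) \<noteq> (0, 1)" "(u, v) \<noteq> (1, 0)"
      using a by auto
    then obtain x y where xy: "x \<in> S" "y \<in> S" "u = h x" "v = h y"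
      using img by (metis imageE lessThan_iff)
    then have "x \<noteq> y" "{x, y} \<noteq> {c, d}"
      using uv h_cd by (auto simp: doubleton_eq_iff)
    then have "x \<rightarrow>\<^bsub>H\<^esub> y"
      using adj xy by blast
    then obtain e where e: "e \<in> arcs H" "tail H e = x" "head H e = y"
      by (rule reachableE)
    then have "e \<in> arcs K" "iso_arcs f e = a"
      using xy uv(1) \<open>{x, y} \<noteq> {c, d}\<close> unfolding K_def f_def by auto
    then show "a \<in> iso_arcs f ` arcs K"
      by blast
  qed
  have "with_proj (complete_graph_minus_edge n) = app_iso f K"
    using arcs_img img
    unfolding with_proj_def complete_graph_minus_edge_def complete_graph_def app_iso_def
    by (simp add: K_def f_def)
  then show ?thesis
    using subK isoK unfolding digraph_iso_def by blast
qed

theorem lemma1p3: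
  fixes H :: "('a,'b) pre_digraph" and p q :: nat
  assumes "graph H"
    and "connected H"
    and "max_degree H \<ge> 7"
    and "free_of (with_proj (complete_graph_minus_edge (max_degree H))) H"
    and "p \<ge> 2" and "q \<ge> 2"
    and "max_degree H + 1 = p + q"
  shows "\<exists>V1 V2. V1 \<union> V2 = verts H \<and> V1 \<inter> V2 = {} \<and> V1 \<noteq> {} \<and> V2 \<noteq> {} \<and>
           free_of (with_proj (complete_graph p)) (H \<restriction> V1) \<and>
           (free_of (with_proj (complete_graph q)) (H \<restriction> V2) \<or> disjoint_cliques q (H \<restriction> V2))"
proof -
  interpret graph H by fact
  let ?V = "verts H" and ?adj = "\<lambda>x y. x \<rightarrow>\<^bsub>H\<^esub> y"
  interpret adjacency ?V ?adj
  proof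
    show "x \<in> verts H" if "x \<rightarrow>\<^bsub>H\<^esub> y" for x y
      using adj_in_verts(1)[OF that] .
    show "y \<rightarrow>\<^bsub>H\<^esub> x" if "x \<rightarrow>\<^bsub>H\<^esub> y" for x y
      using arcs_ends_symmetric[OF sym_arcs that] .
    show "\<not> x \<rightarrow>\<^bsub>H\<^esub> x" for x
      using adj_not_same by blast
  qed simp
  have nbrs_eq: "nbrs x = head H ` out_arcs H x" for x
  proof -
    have "x \<rightarrow>\<^bsub>H\<^esub> y \<longleftrightarrow> y \<in> head H ` out_arcs H x" for y
      unfolding out_arcs_def arcs_ends_conv by auto
    then show ?thesis
      unfolding nbrs_def by blast
  qed
  have deg_le: "card (nbrs x) \<le> out_degree H x" for x
    unfolding nbrs_eq out_degree_def by (rule card_image_le) (simp add: out_arcs_def)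
  have max_le: "out_degree H x \<le> max_degree H" if "x \<in> ?V" for x
    unfolding max_degree_def using that by (intro Max_ge) auto
  have deg: "card (nbrs x) + 1 \<le> p + q" for x
  proof (cases "x \<in> ?V")
    case True
    then show ?thesis
      using deg_le[of x] max_le[of x] assms(7) by linarith
  next
    case False
    then have "nbrs x = {}"
      using adj_in_V unfolding nbrs_def by blast
    then show ?thesis
      using assms(5) by simp
  qed
  have no_near: "\<not> near_clique S" if S: "S \<subseteq> ?V" "card S + 1 = p + q" for S
  proof
    assume near: "near_clique S"
    have cS: "card S = max_degree H"
      using S(2) assms(7) by simp
    obtain c d where cd: "c \<in> S" "d \<in> S" "c \<noteq> d"
      and adj: "\<And>x y. x \<in> S \<Longrightarrow> y \<in> S \<Longrightarrow> x \<noteq> y \<Longrightarrow> {x, y} \<noteq> {c, d} \<Longrightarrow> x \<rightarrow>\<^bsub>H\<^esub> y"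
    proof (cases "clique S")
      case True
      have "\<not> card S \<le> Suc 0"
        using cS assms(3) by simp
      then obtain c d where "c \<in> S" "d \<in> S" "c \<noteq> d"
        using card_le_Suc0_iff_eq[of S] finite_subset[OF S(1)] by auto
      then show thesis
        using that[of c d] True unfolding clique_def by blast
    next
      case False
      then obtain c d where cd: "c \<in> S" "d \<in> S" "c \<noteq> d" "d \<notin> nbrs c"
        using cliqueI by blast
      show thesis
        using that[OF cd(1-3)] near_clique_nonadjacent[OF near cd] unfolding nbrs_def by blast
    qed
    show False
      using complete_minus_edge_copy[OF assms(1) S(1) cS cd adj] assms(4) unfolding free_of_def by blast
  qed
  interpret degree_split ?V ?adj p q
    by unfold_locales (use assms(5,6) deg no_near in auto)
  have "?V \<noteq> {}"
    using assms(2) unfolding connected_def strongly_connected_def by (simp add: mk_symmetric_def)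
  then have "max_degree H \<in> out_degree H ` ?V"
    unfolding max_degree_def by (intro Max_in) auto
  then obtain x where x: "x \<in> ?V" "out_degree H x = max_degree H"
    by auto
  have "inj_on (head H) (out_arcs H x)"
    by (rule inj_onI) (auto simp: out_arcs_def arc_to_ends_def intro: no_multi_arcs)
  then have "card (nbrs x) = max_degree H"
    using x(2) unfolding nbrs_eq out_degree_def by (simp add: card_image)
  then have "7 \<le> card ?V"
    using card_mono[OF finite_V nbrs_subset[of x]] assms(3) by simp
  then obtain V1 V2 where parts: "V1 \<union> V2 = ?V" "V1 \<inter> V2 = {}" "V1 \<noteq> {}" "V2 \<noteq> {}"
    and free: "clique_free p V1" and disj: "cliques_disjoint q V2"
    using partition_into_proper_parts assms(3,7) by auto
  have "free_of (with_proj (complete_graph p)) (H \<restriction> V1)"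
    unfolding free_of_def
  proof
    assume "\<exists>S. subgraph S (H \<restriction> V1) \<and> digraph_iso S (with_proj (complete_graph p))"
    then obtain S where S: "subgraph S (H \<restriction> V1)" "digraph_iso S (with_proj (complete_graph p))"
      by blast
    have "arcs_ends (H \<restriction> V1) \<subseteq> arcs_ends H"
      unfolding arcs_ends_conv by (auto simp: induce_subgraph_def)
    then have "clique (verts S)"
      using clique_of_complete_graph_copy(2)[OF S] unfolding clique_def by blast
    moreover have "verts S \<subseteq> V1"
      using S(1) unfolding subgraph_def by simp
    ultimately show False
      using free clique_of_complete_graph_copy(1)[OF S] unfolding clique_free_def by blast
  qed
  moreover have "disjoint_cliques q (H \<restriction> V2)"
    unfolding disjoint_cliques_def
  proof (intro allI impI)
    fix C D assume CD: "clique_of q (H \<restriction> V2) C \<and> clique_of q (H \<restriction> V2) D \<and> C \<noteq> D"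
    have sub: "subgraph (H \<restriction> V2) H"
      using parts(1) by (intro subgraph_induce_subgraphI) blast
    have *: "subgraph K H \<and> verts K \<subseteq> V2 \<and> complete_digraph q K \<and> clique (verts K) \<and> card (verts K) = q"
      if K: "clique_of q (H \<restriction> V2) K" for K
    proof -
      have K': "subgraph K (H \<restriction> V2)" "complete_digraph q K"
        using K unfolding clique_of_def by auto
      have KH: "subgraph K H"
        using subgraph_trans[OF K'(1) sub] .
      then have "arcs_ends K \<subseteq> arcs_ends H"
        unfolding subgraph_def compatible_def arcs_ends_conv by auto
      then have "clique (verts K)"
        using K'(2) unfolding complete_digraph_def clique_def by auto
      moreover have "verts K \<subseteq> V2"
        using K'(1) unfolding subgraph_def by simp
      ultimately show ?thesis
        using KH K'(2) unfolding complete_digraph_def by simp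
    qed
    have "verts C \<noteq> verts D"
      using CD *[of C] *[of D] complete_subgraph_eqI[OF assms(1)] by blast
    then show "verts C \<inter> verts D = {}"
      using disj *[of C] *[of D] CD unfolding cliques_disjoint_def by blast
  qed
  ultimately show ?thesis
    using parts by blast
qed

end
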